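(* Let $T$ be a tournament on a finite non-empty set $X$, with optimal strategy $p^{\ast}\in\Delta(X)$. For any initial urn $n_0\in\mathcal N$, the random urn sequence $(n_\tau)_{\tau\in\mathbb N}$ obtained from $n_0$ by three-alternatives reinforcement satisfies, almost surely, $$\lim_{\tau\to\infty}\widetilde{n_\tau}=p^{\ast}.$$
   Context: A tournament $T$ on a finite set $X$ is a complete antisymmetric binary relation: for any $x,y\in X$ exactly one of $x=y$, $x\,T\,y$, $y\,T\,x$ holds. Write $\max\{x,y\}=x$ if $x\,T\,y$ or $x=y$, and $\max\{x,y\}=y$ if $y\,T\,x$. $\Delta(X)$ is the set of probability distributions on $X$. Tournament game: $g(x,y)=+1$ if $x\,T\,y$, $g(x,y)=0$ if $x=y$, $g(x,y)=-1$ if $y\,T\,x$; for $p,q\in\Delta(X)$, $g(p,q)=\sum_{x,y\in X}g(x,y)p(x)q(y)$. It is a known fact that there is a unique $p^{\ast}\in\Delta(X)$ such that $g(p^{\ast},q)\ge 0$ for all $q\in\Delta(X)$; it is called the optimal strategy. An urn on $X$ is a family $n=(n(x))_{x\in X}$ of strictly positive integers ($n(x)$ is the number of balls of color $x$); $\mathcal N$ is the set of urns. For $n\in\mathcal N$, $\widetilde n\in\Delta(X)$ is defined by $\widetilde n(x)=n(x)/\sum_{y\in X}n(y)$. Three-alternatives reinforcement is the Markov chain $(n_\tau)_{\tau\in\mathbb N}$ on $\mathcal N$ defined as follows: given $n_\tau$, draw $a,b,c\in X$ independently according to $\widetilde{n_\tau}$, put $x=\max\{\max\{a,b\},c\}$,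 and add one ball of color $x$, i.e. $n_{\tau+1}(x)=n_\tau(x)+1$ and $n_{\tau+1}(v)=n_\tau(v)$ for $v\ne x$. *)

theory Defs
  imports "HOL-Probability.Probability"
begin

definition tournament :: "'a set \<Rightarrow> ('a \<Rightarrow> 'a \<Rightarrow> bool) \<Rightarrow> bool" where
  "tournament X T \<longleftrightarrow>
     (\<forall>x\<in>X. \<forall>y\<in>X.
        (x = y \<and> \<not> T x y \<and> \<not> T y x) \<or>
        (x \<noteq> y \<and> T x y \<and> \<not> T y x) \<or>
        (x \<noteq> y \<and> \<not> T x y \<and> T y x))"

definition tmax :: "('a \<Rightarrow> 'a \<Rightarrow> bool) \<Rightarrow> 'a \<Rightarrow> 'a \<Rightarrow> 'a" where
  "tmax T x y = (if T x y \<or> x = y then x else y)"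

text \<open>Families indexed by \<open>X\<close> (strategies, urns) are functions that vanish outside \<open>X\<close>,
  so that distinct functions represent distinct families.\<close>

definition distributions :: "'a set \<Rightarrow> ('a \<Rightarrow> real) set" where
  "distributions X = {p. (\<forall>x\<in>X. 0 \<le> p x) \<and> (\<Sum>x\<in>X. p x) = 1 \<and> (\<forall>x. x \<notin> X \<longrightarrow> p x = 0)}"

definition payoff :: "('a \<Rightarrow> 'a \<Rightarrow> bool) \<Rightarrow> 'a \<Rightarrow> 'a \<Rightarrow> real" where
  "payoff T x y = (if T x y then 1 else if T y x then -1 else 0)"

definition mixed_payoff ::
    "'a set \<Rightarrow> ('a \<Rightarrow> 'a \<Rightarrow> bool) \<Rightarrow> ('a \<Rightarrow> real) \<Rightarrow> ('a \<Rightarrow> real) \<Rightarrow> real" where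
  "mixed_payoff X T p q = (\<Sum>x\<in>X. \<Sum>y\<in>X. payoff T x y * p x * q y)"

definition optimal_strategy :: "'a set \<Rightarrow> ('a \<Rightarrow> 'a \<Rightarrow> bool) \<Rightarrow> ('a \<Rightarrow> real) \<Rightarrow> bool" where
  "optimal_strategy X T p \<longleftrightarrow>
     p \<in> distributions X \<and> (\<forall>q\<in>distributions X. 0 \<le> mixed_payoff X T p q)"

definition urns :: "'a set \<Rightarrow> ('a \<Rightarrow> nat) set" where
  "urns X = {n. (\<forall>x\<in>X. 0 < n x) \<and> (\<forall>x. x \<notin> X \<longrightarrow> n x = 0)}"

definition composition :: "'a set \<Rightarrow> ('a \<Rightarrow> nat) \<Rightarrow> 'a \<Rightarrow> real" where
  "composition X n x = real (n x) / real (\<Sum>y\<in>X. n y)"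

lemma composition_in_distributions:
  assumes "finite X" "X \<noteq> {}" "n \<in> urns X"
  shows "composition X n \<in> distributions X"
proof -
  have "0 < (\<Sum>y\<in>X. n y)"
    using assms by (intro sum_pos) (auto simp: urns_def)
  then show ?thesis
    using assms(3)
    by (auto simp: distributions_def composition_def urns_def sum_divide_distrib[symmetric]
        simp flip: of_nat_sum)
qed

text \<open>\<open>embed_pmf\<close> is only meaningful on genuine probability mass functions; \<open>pmf_draw\<close> shows
  that this is the case for every urn.\<close>

definition draw :: "'a set \<Rightarrow> ('a \<Rightarrow> nat) \<Rightarrow> 'a pmf" where
  "draw X n = embed_pmf (composition X n)"

lemma pmf_draw:
  assumes "finite X" "X \<noteq> {}" "n \<in> urns X"
  shows "pmf (draw X n) x = composition X n x"
  unfolding draw_def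
proof (rule pmf_embed_pmf)
  have d: "composition X n \<in> distributions X"
    by (rule composition_in_distributions) fact+
  show "0 \<le> composition X n x" for x
    by (simp add: composition_def sum_nonneg)
  have "(\<integral>\<^sup>+x. ennreal (composition X n x) \<partial>count_space UNIV)
      = (\<Sum>x\<in>X. ennreal (composition X n x))"
    using d assms(1) by (intro nn_integral_count_space') (auto simp: distributions_def)
  also have "\<dots> = ennreal (\<Sum>x\<in>X. composition X n x)"
    by (rule sum_ennreal) (simp add: composition_def sum_nonneg)
  also have "\<dots> = 1"
    using d by (simp add: distributions_def)
  finally show "(\<integral>\<^sup>+x. ennreal (composition X n x) \<partial>count_space UNIV) = 1" .
qed

definition three_alternatives_step ::
    "'a set \<Rightarrow> ('a \<Rightarrow> 'a \<Rightarrow> bool) \<Rightarrow> ('a \<Rightarrow> nat) \<Rightarrow> ('a \<Rightarrow> nat) pmf" where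
  "three_alternatives_step X T n =
     map_pmf (\<lambda>(a, b, c). let x = tmax T (tmax T a b) c in n(x := n x + 1))
       (pair_pmf (draw X n) (pair_pmf (draw X n) (draw X n)))"

text \<open>\<open>N\<close> is a time-homogeneous Markov chain with values in the set \<open>S\<close>, which is meant to be
  countable, and with transition kernel \<open>K\<close>.\<close>

definition markov_chain ::
    "'w measure \<Rightarrow> 's set \<Rightarrow> ('s \<Rightarrow> 's pmf) \<Rightarrow> (nat \<Rightarrow> 'w \<Rightarrow> 's) \<Rightarrow> bool" where
  "markov_chain M S K N \<longleftrightarrow>
     (\<forall>t. N t \<in> M \<rightarrow>\<^sub>M count_space S) \<and>
     (\<forall>t s s'. 0 < \<P>(\<omega> in M. \<forall>i\<le>t. N i \<omega> = s i) \<longrightarrow>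
        \<P>(\<omega> in M. N (Suc t) \<omega> = s' \<bar> \<forall>i\<le>t. N i \<omega> = s i) = pmf (K (s t)) s')"

definition three_alternatives_reinforcement ::
    "'w measure \<Rightarrow> 'a set \<Rightarrow> ('a \<Rightarrow> 'a \<Rightarrow> bool) \<Rightarrow> ('a \<Rightarrow> nat) \<Rightarrow>
     (nat \<Rightarrow> 'w \<Rightarrow> 'a \<Rightarrow> nat) \<Rightarrow> bool" where
  "three_alternatives_reinforcement M X T n0 N \<longleftrightarrow>
     markov_chain M (urns X) (three_alternatives_step X T) N \<and> (AE \<omega> in M. N 0 \<omega> = n0)"

end

theory Submission
  imports Defs
begin

text \<open>The process is driven towards \<open>p\<close> by relative entropy. Let \<open>q\<close> be the composition of an urn with
  \<open>N\<close> balls and \<open>g x\<close> the payoff of \<open>x\<close> against \<open>q\<close>. The colour \<open>x\<close> is reinforced with probability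
  \<open>q x * (1 + 3/2 * g x + 1/2 * (g x)\<^sup>2 + 1/2 * h x)\<close>, where \<open>h x\<close> is the payoff of \<open>x\<close> against the
  weights \<open>q m * g m\<close> (\<open>pmf_winner\<close>). Averaging over the optimal strategy, \<open>\<Sum>x. p x * ln (q x)\<close> has, to first order, a
  drift of at least \<open>1/N\<close> times
  \<open>drift_bound X T p q = mixed_payoff X T p q + 1/2 * (\<Sum>x. p x * (g x)\<^sup>2)\<close>, which is nonnegative
  (\<open>relative_growth_ge\<close>, \<open>drift_bound_nonneg\<close>).

  The drift vanishes only at \<open>q = p\<close> (\<open>drift_bound_zero\<close>). This is where the tournament structure
  enters: the payoff matrix of an even number of alternatives is nonsingular by parity
  (\<open>even_tournament_kernel\<close>). Therefore an alternative that does not lose against \<open>p\<close> has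
  positive weight in \<open>p\<close>, and \<open>p\<close> is the only strategy on this support against which every
  alternative of the support breaks even.

  With harmonic numbers in place of logarithms the drift computation is exact, and the resulting
  potential is a nonnegative supermartingale that decreases on average by \<open>drift_bound / N\<close>
  (\<open>expectation_potential_le\<close>). So the sum of these decrements is almost surely finite. As \<open>N\<close> grows by
  one at each step and the harmonic series diverges, the drift is small infinitely often; by
  compactness the composition then is close to \<open>p\<close>, and the potential is close to its least
  possible limit (\<open>entropy_gap_small_if_drift_small\<close>). A nonnegative supermartingale that comes
  arbitrarily close to \<open>0\<close> is unlikely to grow again, by the maximal inequality, so the relative entropy
  tends to \<open>0\<close> along the whole sequence (\<open>AE_limsup_nonpos_of_returns\<close>). It dominates the squared
  Hellinger distance between \<open>p\<close> and \<open>q\<close> (\<open>hellinger_le_entropy_gap\<close>), which gives convergence.\<close>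

section \<open>Parity and the support of the optimal strategy\<close>

definition gain :: "'a set \<Rightarrow> ('a \<Rightarrow> 'a \<Rightarrow> bool) \<Rightarrow> ('a \<Rightarrow> real) \<Rightarrow> 'a \<Rightarrow> real" where
  "gain X T q x = (\<Sum>y\<in>X. payoff T x y * q y)"

text \<open>Real solutions of a linear system with integer coefficients are brought down to rational ones by
  applying a \<open>\<rat>\<close>-linear functional on \<open>\<real>\<close> to every coordinate: it commutes with integer
  coefficients, and it can be chosen not to annihilate a given coordinate.\<close>

lemma additive_rational_functional:
  fixes v :: real
  assumes "v \<noteq> 0"
  obtains \<phi> :: "real \<Rightarrow> rat" where "Modules.additive \<phi>" "\<phi> v \<noteq> 0"
proof -
  interpret Q: vector_space "\<lambda>(q::rat) (r::real). of_rat q * r"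
    by unfold_locales (auto simp: algebra_simps of_rat_add of_rat_mult)
  define B where "B = Q.extend_basis {v}"
  have iv: "Q.independent {v}" using assms by simp
  have B: "Q.independent B" "v \<in> B" "Q.span B = UNIV"
    unfolding B_def using Q.independent_extend_basis[OF iv] Q.extend_basis_superset[OF iv]
      Q.span_extend_basis[OF iv] by auto
  show thesis
  proof
    show "Modules.additive (\<lambda>r. Q.representation B r v)"
      by unfold_locales (use B in \<open>simp add: Q.representation_add\<close>)
    show "Q.representation B v v \<noteq> 0"
      using B by (simp add: Q.representation_basis)
  qed
qed

lemma common_denominator:
  fixes r :: "'a \<Rightarrow> rat"
  assumes "finite Y"
  obtains d :: int and k :: "'a \<Rightarrow> int"
  where "d > 0" "\<And>y. y \<in> Y \<Longrightarrow> of_int d * r y = of_int (k y)"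
proof -
  have "\<exists>d::int. d > 0 \<and> (\<forall>y\<in>Y. of_int d * r y \<in> \<int>)"
    using assms
  proof (induction Y)
    case empty
    show ?case by (auto intro: exI[of _ 1])
  next
    case (insert z Y)
    then obtain d :: int where d: "d > 0" "\<forall>y\<in>Y. of_int d * r y \<in> \<int>" by auto
    obtain a b where ab: "quotient_of (r z) = (a, b)" by fastforce
    have b: "b > 0" "r z = of_int a / of_int b"
      using quotient_of_denom_pos[OF ab] quotient_of_div[OF ab] by auto
    have "of_int (b * d) * r y \<in> \<int>" if "y \<in> insert z Y" for y
    proof (cases "y = z")
      case True
      then have "of_int (b * d) * r y = of_int (d * a)" using b by simp
      then show ?thesis by (metis Ints_of_int)
    next
      case False
      then have "of_int d * r y \<in> \<int>" using d that by auto
      then have "of_int b * (of_int d * r y) \<in> \<int>" by (rule Ints_mult[OF Ints_of_int])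
      then show ?thesis by (simp add: mult.assoc)
    qed
    then show ?case using b d by (intro exI[of _ "b * d"]) auto
  qed
  then obtain d :: int where d: "d > 0" "\<forall>y\<in>Y. of_int d * r y \<in> \<int>" by auto
  then have "\<forall>y. \<exists>k. y \<in> Y \<longrightarrow> of_int d * r y = of_int k" by (metis Ints_cases)
  then obtain k where "\<And>y. y \<in> Y \<Longrightarrow> of_int d * r y = of_int (k y)" by metis
  with d(1) show thesis by (rule that)
qed

definition signs :: "('a \<Rightarrow> 'a \<Rightarrow> bool) \<Rightarrow> 'a \<Rightarrow> 'a \<Rightarrow> int" where
  "signs T x y = (if T x y then 1 else if T y x then -1 else 0)"

lemma payoff_eq_signs: "payoff T x y = of_int (signs T x y)"
  by (simp add: payoff_def signs_def)

lemma tournament_subset: "tournament X T \<Longrightarrow> Y \<subseteq> X \<Longrightarrow> tournament Y T"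
  unfolding tournament_def subset_iff by blast

lemma tournament_cases:
  assumes "tournament X T" "x \<in> X" "y \<in> X"
  shows "(x = y \<and> \<not> T x y \<and> \<not> T y x) \<or> (x \<noteq> y \<and> T x y \<and> \<not> T y x)
    \<or> (x \<noteq> y \<and> \<not> T x y \<and> T y x)"
  using assms unfolding tournament_def by blast

lemma odd_signs:
  assumes "tournament X T" "x \<in> X" "y \<in> X"
  shows "odd (signs T x y) \<longleftrightarrow> x \<noteq> y"
  using tournament_cases[OF assms] by (auto simp: signs_def)

lemma even_sum_cong:
  fixes f g :: "'a \<Rightarrow> int"
  assumes "\<And>x. x \<in> A \<Longrightarrow> even (f x) = even (g x)"
  shows "even (sum f A) = even (sum g A)"
  using assms by (induction A rule: infinite_finite_induct) auto

text \<open>Modulo \<open>2\<close> the payoff matrix of a tournament is the all-ones matrix minus the identity,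
  whatever the tournament. So a kernel vector has all its entries congruent to their sum \<open>s\<close>, and
  summing \<open>s - v x\<close> over an even number of alternatives shows that \<open>s\<close> itself is even. All entries
  are even then, and halving the vector gives an infinite descent.\<close>

lemma even_tournament_kernel_int:
  fixes v :: "'a \<Rightarrow> int"
  assumes "finite Y" "even (card Y)" "tournament Y T"
    and "\<And>x. x \<in> Y \<Longrightarrow> (\<Sum>y\<in>Y. signs T x y * v y) = 0" and "z \<in> Y"
  shows "v z = 0"
  using assms(4)
proof (induction "\<Sum>y\<in>Y. nat \<bar>v y\<bar>" arbitrary: v rule: less_induct)
  case less
  define s where "s = (\<Sum>y\<in>Y. v y)"
  have *: "even (s - v x)" if "x \<in> Y" for x
  proof -
    have "even (\<Sum>y\<in>Y - {x}. v y) = even (\<Sum>y\<in>Y - {x}. signs T x y * v y)"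
      using odd_signs[OF assms(3)] that by (intro even_sum_cong) auto
    also have "(\<Sum>y\<in>Y - {x}. signs T x y * v y) = (\<Sum>y\<in>Y. signs T x y * v y)"
      using assms(3) that
      by (intro sum.mono_neutral_left) (auto simp: assms(1) tournament_def signs_def)
    finally show ?thesis
      using less.prems that assms(1) by (simp add: s_def sum_diff1)
  qed
  have "even (\<Sum>x\<in>Y. s - v x)"
    using * by (intro dvd_sum) auto
  also have "(\<Sum>x\<in>Y. s - v x) = int (card Y) * s - s"
    by (simp add: sum_subtractf s_def)
  finally have "even s" using assms(2) by auto
  then have ev: "even (v x)" if "x \<in> Y" for x using *[OF that] by auto
  define u where "u x = v x div 2" for x
  have vu: "v x = 2 * u x" if "x \<in> Y" for x using ev[OF that] by (simp add: u_def)
  show ?case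
  proof (rule ccontr)
    assume nz: "v z \<noteq> 0"
    have "(\<Sum>y\<in>Y. nat \<bar>u y\<bar>) < (\<Sum>y\<in>Y. nat \<bar>v y\<bar>)"
    proof (rule sum_strict_mono_ex1)
      show "\<exists>y\<in>Y. nat \<bar>u y\<bar> < nat \<bar>v y\<bar>" using nz vu[OF assms(5)] assms(5) by (intro bexI[of _ z]) auto
    qed (use assms(1) vu in auto)
    moreover have "(\<Sum>y\<in>Y. signs T x y * u y) = 0" if "x \<in> Y" for x
    proof -
      have "2 * (\<Sum>y\<in>Y. signs T x y * u y) = (\<Sum>y\<in>Y. signs T x y * v y)"
        unfolding sum_distrib_left by (intro sum.cong) (auto simp: vu)
      then show ?thesis using less.prems[OF that] by simp
    qed
    ultimately have "u z = 0" by (rule less.hyps)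
    then show False using nz vu assms(5) by auto
  qed
qed

lemma even_tournament_kernel:
  fixes v :: "'a \<Rightarrow> real"
  assumes "finite Y" "even (card Y)" "tournament Y T"
    and ker: "\<And>x. x \<in> Y \<Longrightarrow> gain Y T v x = 0" and "z \<in> Y"
  shows "v z = 0"
proof (rule ccontr)
  assume "v z \<noteq> 0"
  then obtain \<phi> :: "real \<Rightarrow> rat" where "Modules.additive \<phi>" and nz: "\<phi> (v z) \<noteq> 0"
    by (rule additive_rational_functional)
  interpret additive \<phi> by fact
  obtain d :: int and k where d: "d > 0" "\<And>y. y \<in> Y \<Longrightarrow> of_int d * \<phi> (v y) = of_int (k y)"
    using common_denominator[OF assms(1), of "\<lambda>y. \<phi> (v y)"] by auto
  have sgn: "\<phi> (of_int (signs T x y) * r) = of_int (signs T x y) * \<phi> r" for x y r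
    by (simp add: signs_def minus zero)
  have "(\<Sum>y\<in>Y. signs T x y * k y) = 0" if "x \<in> Y" for x
  proof -
    have "(of_int (\<Sum>y\<in>Y. signs T x y * k y) :: rat)
        = (\<Sum>y\<in>Y. of_int (signs T x y) * (of_int d * \<phi> (v y)))"
      using d(2) by simp
    also have "\<dots> = of_int d * \<phi> (gain Y T v x)"
      by (simp add: gain_def sum sgn payoff_eq_signs sum_distrib_left mult.left_commute)
    also have "\<dots> = 0" using ker[OF that] by (simp add: zero)
    finally show ?thesis by (simp only: of_int_eq_0_iff)
  qed
  then have "k z = 0"
    by (rule even_tournament_kernel_int[OF assms(1-3) _ assms(5)])
  then show False using d(1) d(2)[OF assms(5)] nz by simp
qed

lemma payoff_antisym: "tournament X T \<Longrightarrow> x \<in> X \<Longrightarrow> y \<in> X \<Longrightarrow> payoff T y x = - payoff T x y"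
  using tournament_cases[of X T x y] by (auto simp: payoff_def)

lemma mixed_payoff_eq_gain: "mixed_payoff X T p q = (\<Sum>x\<in>X. p x * gain X T q x)"
  by (simp add: mixed_payoff_def gain_def sum_distrib_left mult_ac)

lemma mixed_payoff_antisym:
  assumes "tournament X T"
  shows "mixed_payoff X T p q = - mixed_payoff X T q p"
proof -
  have "mixed_payoff X T p q = (\<Sum>y\<in>X. \<Sum>x\<in>X. payoff T x y * p x * q y)"
    unfolding mixed_payoff_def by (rule sum.swap)
  also have "\<dots> = (\<Sum>y\<in>X. \<Sum>x\<in>X. - (payoff T y x * q y * p x))"
    by (intro sum.cong refl, subst payoff_antisym[OF assms]) (auto simp: mult_ac)
  also have "\<dots> = - mixed_payoff X T q p" by (simp add: mixed_payoff_def sum_negf)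
  finally show ?thesis .
qed

lemma mixed_payoff_self: "tournament X T \<Longrightarrow> mixed_payoff X T p p = 0"
  by (drule mixed_payoff_antisym[of X T p p]) linarith

lemma gain_mono_neutral:
  assumes "finite X" "Y \<subseteq> X" "\<And>y. y \<in> X - Y \<Longrightarrow> q y = 0"
  shows "gain Y T q = gain X T q"
  unfolding gain_def using assms by (intro ext sum.mono_neutral_left) auto

lemma optimal_gain_nonpos:
  assumes "finite X" "tournament X T" "optimal_strategy X T p" "x \<in> X"
  shows "gain X T p x \<le> 0"
proof -
  define e :: "'a \<Rightarrow> real" where "e y = (if y = x then 1 else 0)" for y
  have "e \<in> distributions X" using assms by (auto simp: distributions_def e_def)
  then have "0 \<le> mixed_payoff X T p e" using assms by (simp add: optimal_strategy_def)
  also have "\<dots> = - mixed_payoff X T e p" by (rule mixed_payoff_antisym) fact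
  also have "mixed_payoff X T e p = gain X T p x"
    using assms by (simp add: mixed_payoff_eq_gain e_def if_distrib[of "\<lambda>c. c * _"] cong: if_cong)
  finally show ?thesis by simp
qed

text \<open>Let \<open>S = {x. gain X T p x = 0}\<close>, which contains the support of \<open>p\<close>. For any \<open>Y\<close> between the two,
  the restriction of \<open>p\<close> to \<open>Y\<close> lies in the kernel of the payoff matrix of \<open>Y\<close>, so \<open>Y\<close> has odd size. If the support were smaller than \<open>S\<close>, removing one unused alternative from \<open>S\<close>
  would give an even \<open>Y\<close>.\<close>

lemma optimal_strict_complementarity:
  assumes "finite X" "tournament X T" "optimal_strategy X T p" "x \<in> X"
  shows "gain X T p x = 0 \<longleftrightarrow> p x > 0"
proof -
  define S where "S = {x \<in> X. gain X T p x = 0}"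
  have dist: "\<And>x. x \<in> X \<Longrightarrow> 0 \<le> p x" "sum p X = 1"
    using assms by (auto simp: optimal_strategy_def distributions_def)
  have "(\<Sum>x\<in>X. - (p x * gain X T p x)) = 0"
    using mixed_payoff_self[OF assms(2), of p] by (simp add: mixed_payoff_eq_gain sum_negf)
  moreover have "0 \<le> - (p x * gain X T p x)" if "x \<in> X" for x
    using dist(1)[OF that] optimal_gain_nonpos[OF assms(1-3) that] by (simp add: mult_nonneg_nonpos)
  ultimately have "p y * gain X T p y = 0" if "y \<in> X" for y
    using sum_nonneg_eq_0_iff[OF assms(1), of "\<lambda>x. - (p x * gain X T p x)"] that by auto
  then have supp: "p y = 0" if "y \<in> X - S" for y using that by (auto simp: S_def)
  have S: "S \<subseteq> X" "finite S" using assms(1) by (auto simp: S_def)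
  have p_nz: "\<exists>y\<in>S. p y \<noteq> 0"
  proof (rule ccontr)
    assume "\<not> ?thesis"
    then have "sum p X = 0" using supp by (intro sum.neutral) auto
    then show False using dist by simp
  qed
  \<comment> \<open>an even set between the support of \<open>p\<close> and \<open>S\<close> would force \<open>p = 0\<close>\<close>
  have full: "even (card Y) \<Longrightarrow> Y \<subseteq> S \<Longrightarrow> (\<And>y. y \<in> S - Y \<Longrightarrow> p y = 0) \<Longrightarrow> False" for Y
  proof -
    assume Y: "even (card Y)" "Y \<subseteq> S" "\<And>y. y \<in> S - Y \<Longrightarrow> p y = 0"
    have "p y = 0" if "y \<in> Y" for y
    proof (rule even_tournament_kernel[OF _ Y(1) _ _ that])
      show "finite Y" using Y S finite_subset by blast
      show "tournament Y T" using tournament_subset[OF assms(2)] Y S by blast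
      show "gain Y T p x = 0" if "x \<in> Y" for x
        using that Y supp S assms(1) by (subst gain_mono_neutral[of X]) (auto simp: S_def)
    qed
    then show False using p_nz Y by auto
  qed
  have "odd (card S)" using full[of S] by auto
  then have "even (card (S - {x}))" if "x \<in> S" using that S by simp
  then have "p x \<noteq> 0" if "x \<in> S" using full[of "S - {x}"] that by auto
  then show ?thesis using supp assms(4) dist(1)[OF assms(4)] by (force simp: S_def)
qed

text \<open>Subtracting from \<open>q\<close> the multiple of \<open>p\<close> that makes one coordinate \<open>z\<close> vanish leaves a kernel
  vector of the subtournament on the support without \<open>z\<close>, which has even size. Hence \<open>q\<close> is
  proportional to \<open>p\<close>.\<close>

lemma optimal_unique_on_support:
  assumes "finite X" "tournament X T" "optimal_strategy X T p" "q \<in> distributions X"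
    and supp: "\<And>x. x \<in> X \<Longrightarrow> p x = 0 \<Longrightarrow> q x = 0"
    and ker: "\<And>x. x \<in> X \<Longrightarrow> p x > 0 \<Longrightarrow> gain X T q x = 0" and "x \<in> X"
  shows "q x = p x"
proof -
  define S where "S = {x \<in> X. p x > 0}"
  have S: "S \<subseteq> X" "finite S" using assms(1) by (auto simp: S_def)
  have dist: "\<And>x. x \<in> X \<Longrightarrow> 0 \<le> p x" "sum p X = 1" "sum q X = 1"
    using assms(3,4) by (auto simp: optimal_strategy_def distributions_def)
  have out: "p y = 0" "q y = 0" if "y \<in> X - S" for y
    using that dist(1)[of y] supp[of y] by (auto simp: S_def less_le)
  obtain z where z: "z \<in> S"
  proof (cases "S = {}")
    case True
    then have "sum p X = 0" using out by (intro sum.neutral) auto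
    then show ?thesis using dist by simp
  qed auto
  have "even (card S) \<Longrightarrow> p z = 0"
  proof (rule even_tournament_kernel[OF S(2) _ _ _ z])
    show "tournament S T" using tournament_subset[OF assms(2)] S by blast
    show "gain S T p x = 0" if "x \<in> S" for x
    proof -
      have "gain S T p = gain X T p"
        using assms(1) S(1) out(1) by (rule gain_mono_neutral)
      then show ?thesis
        using that optimal_strict_complementarity[OF assms(1-3), of x] by (simp add: S_def)
    qed
  qed
  then have odd: "odd (card S)" using z by (auto simp: S_def)
  define c where "c = q z / p z"
  define v where "v y = q y - c * p y" for y
  have vz: "v z = 0" using z by (simp add: v_def c_def S_def)
  have gv: "gain X T v y = gain X T q y - c * gain X T p y" for y
    by (simp add: gain_def v_def algebra_simps sum_subtractf sum_distrib_left)
  have v0: "v y = 0" if "y \<in> S - {z}" for y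
  proof (rule even_tournament_kernel[OF _ _ _ _ that])
    show "finite (S - {z})" "even (card (S - {z}))" using S odd z by auto
    show "tournament (S - {z}) T" using tournament_subset[OF assms(2)] S by blast
    show "gain (S - {z}) T v x = 0" if "x \<in> S - {z}" for x
    proof -
      have "gain (S - {z}) T v = gain X T v"
      proof (rule gain_mono_neutral)
        show "v y = 0" if "y \<in> X - (S - {z})" for y
          using that vz out[of y] by (cases "y = z") (auto simp: v_def)
      qed (use assms(1) S in auto)
      then show ?thesis using that ker optimal_strict_complementarity[OF assms(1-3), of x]
        by (auto simp: gv S_def)
    qed
  qed
  have v: "v y = 0" if "y \<in> X" for y using that v0[of y] vz out[of y]
    by (cases "y \<in> S") (auto simp: v_def)
  have "sum v X = sum q X - c * sum p X"
    by (simp add: v_def sum_subtractf sum_distrib_left)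
  then have "c = 1" using v dist by simp
  then show ?thesis using v[OF assms(7)] by (simp add: v_def)
qed

section \<open>The law of the reinforced colour\<close>

text \<open>With \<open>\<beta> b = 1\<close> when \<open>m\<close> beats or equals \<open>b\<close> and \<open>\<beta> b = 0\<close> otherwise, the maximum is \<open>m\<close> when one of
  the two draws is \<open>m\<close> and the other has \<open>\<beta> = 1\<close>, and \<open>\<beta>\<close> is affine in the payoff against \<open>m\<close>.
  Stating this for two different laws lets it be applied twice to three draws.\<close>

lemma pmf_tmax_pair:
  assumes "finite X" "tournament X T" "set_pmf P \<subseteq> X" "set_pmf Q \<subseteq> X" "m \<in> X"
  shows "pmf (map_pmf (\<lambda>(a, b). tmax T a b) (pair_pmf P Q)) m
    = (pmf P m * (1 + gain X T (pmf Q) m) + pmf Q m * (1 + gain X T (pmf P) m)) / 2"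
proof -
  let ?r = "pmf P" and ?q = "pmf Q"
  define \<beta> where "\<beta> b = (1 + payoff T m b + of_bool (b = m)) / 2" for b
  have tm: "of_bool (tmax T a b = m) = of_bool (a = m) * \<beta> b + of_bool (b = m) * \<beta> a
      - of_bool (a = m) * of_bool (b = m)" if "a \<in> X" "b \<in> X" for a b
    using tournament_cases[OF assms(2) that] tournament_cases[OF assms(2) that(1) assms(5)]
      tournament_cases[OF assms(2) that(2) assms(5)]
    by (elim disjE) (simp_all add: \<beta>_def tmax_def payoff_def)
  have one: "sum ?r X = 1" "sum ?q X = 1" using assms by (auto intro: sum_pmf_eq_1)
  have \<beta>: "(\<Sum>b\<in>X. s b * \<beta> b) = (sum s X + gain X T s m + s m) / 2" for s
  proof -
    have "(\<Sum>b\<in>X. s b * of_bool (b = m)) = s m"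
      using assms by (simp add: of_bool_def if_distrib cong: if_cong)
    then show ?thesis
      by (simp add: \<beta>_def gain_def sum.distrib algebra_simps sum_distrib_left sum_divide_distrib[symmetric] add_divide_distrib)
  qed
  have pick: "(\<Sum>a\<in>X. s a * (of_bool (a = m) * c)) = s m * c" for s :: "'a \<Rightarrow> real" and c
  proof -
    have "(\<Sum>a\<in>X. s a * (of_bool (a = m) * c)) = (\<Sum>a\<in>X. if a = m then s a * c else 0)"
      by (intro sum.cong) auto
    then show ?thesis using assms by simp
  qed
  have "pmf (map_pmf (\<lambda>(a, b). tmax T a b) (pair_pmf P Q)) m
      = (\<integral>z. of_bool (tmax T (fst z) (snd z) = m) \<partial>pair_pmf P Q)"
    unfolding map_pmf_def pmf_bind
    by (intro Bochner_Integration.integral_cong refl)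
      (simp add: split_beta pmf_return indicator_def)
  also have "\<dots> = (\<Sum>z\<in>X \<times> X. pmf (pair_pmf P Q) z * of_bool (tmax T (fst z) (snd z) = m))"
    using assms by (subst integral_measure_pmf[of "X \<times> X"]) (auto simp: mult_ac)
  also have "\<dots> = (\<Sum>a\<in>X. \<Sum>b\<in>X. ?r a * ?q b * of_bool (tmax T a b = m))"
    unfolding sum.cartesian_product by (intro sum.cong) (auto simp: pmf_pair)
  also have "\<dots> = (\<Sum>a\<in>X. \<Sum>b\<in>X. ?r a * (of_bool (a = m) * (?q b * \<beta> b))
      + ?q b * (of_bool (b = m) * (?r a * \<beta> a)) - ?r a * (of_bool (a = m) * (?q b * (of_bool (b = m) * 1))))"
    by (intro sum.cong refl) (auto simp: tm algebra_simps)
  also have "\<dots> = ?r m * (\<Sum>b\<in>X. ?q b * \<beta> b) + ?q m * (\<Sum>a\<in>X. ?r a * \<beta> a) - ?r m * ?q m"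
    unfolding sum.distrib sum_subtractf sum_distrib_left[symmetric] pick
    by (simp add: sum_distrib_left[symmetric] pick)
  also have "(\<Sum>b\<in>X. ?q b * \<beta> b) = (1 + gain X T ?q m + ?q m) / 2"
    by (rule \<beta>[of ?q, unfolded one(2)])
  also have "(\<Sum>a\<in>X. ?r a * \<beta> a) = (1 + gain X T ?r m + ?r m) / 2"
    by (rule \<beta>[of ?r, unfolded one(1)])
  finally show ?thesis by (simp add: field_simps)
qed

lemma set_pmf_tmax_pair:
  assumes "set_pmf P \<subseteq> X" "set_pmf Q \<subseteq> X"
  shows "set_pmf (map_pmf (\<lambda>(a, b). tmax T a b) (pair_pmf P Q)) \<subseteq> X"
  using assms by (auto simp: tmax_def)

definition winner :: "'a set \<Rightarrow> ('a \<Rightarrow> 'a \<Rightarrow> bool) \<Rightarrow> ('a \<Rightarrow> nat) \<Rightarrow> 'a pmf" where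
  "winner X T n = map_pmf (\<lambda>(a, b). tmax T a b)
     (pair_pmf (map_pmf (\<lambda>(a, b). tmax T a b) (pair_pmf (draw X n) (draw X n))) (draw X n))"

lemma three_alternatives_step_eq:
  "three_alternatives_step X T n = map_pmf (\<lambda>x. n(x := n x + 1)) (winner X T n)"
  by (simp add: three_alternatives_step_def winner_def pair_pmf_def map_pmf_def bind_assoc_pmf
      bind_return_pmf Let_def)

lemma set_pmf_draw:
  assumes "finite X" "X \<noteq> {}" "n \<in> urns X"
  shows "set_pmf (draw X n) \<subseteq> X"
  using assms by (auto simp: set_pmf_eq pmf_draw composition_def urns_def)

lemma set_pmf_winner:
  assumes "finite X" "X \<noteq> {}" "n \<in> urns X"
  shows "set_pmf (winner X T n) \<subseteq> X"
  unfolding winner_def using set_pmf_draw[OF assms] by (intro set_pmf_tmax_pair)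

lemma pmf_winner:
  fixes X :: "'a set" and n :: "'a \<Rightarrow> nat"
  defines "q \<equiv> composition X n"
  fixes T :: "'a \<Rightarrow> 'a \<Rightarrow> bool"
  defines "g \<equiv> gain X T q"
  assumes "finite X" "X \<noteq> {}" "tournament X T" "n \<in> urns X" "x \<in> X"
  shows "pmf (winner X T n) x
    = q x * (1 + 3 / 2 * g x + (g x)\<^sup>2 / 2 + gain X T (\<lambda>m. q m * g m) x / 2)"
proof -
  note sd = set_pmf_draw[OF assms(3,4,6)]
  have d: "pmf (draw X n) = q" using pmf_draw[OF assms(3,4,6)] by (auto simp: q_def)
  define f where "f = map_pmf (\<lambda>(a, b). tmax T a b) (pair_pmf (draw X n) (draw X n))"
  have f: "pmf f m = q m * (1 + g m)" if "m \<in> X" for m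
    using pmf_tmax_pair[OF assms(3,5) sd sd that] by (simp add: f_def d g_def)
  have gf: "gain X T (pmf f) x = g x + gain X T (\<lambda>m. q m * g m) x"
  proof -
    have "gain X T (pmf f) x = (\<Sum>y\<in>X. payoff T x y * (q y * (1 + g y)))"
      unfolding gain_def by (intro sum.cong) (auto simp: f)
    also have "\<dots> = g x + gain X T (\<lambda>m. q m * g m) x"
      by (subst (2) g_def) (simp add: gain_def algebra_simps sum.distrib)
    finally show ?thesis .
  qed
  have "pmf (winner X T n) x
      = (pmf f x * (1 + gain X T (pmf (draw X n)) x) + pmf (draw X n) x * (1 + gain X T (pmf f) x)) / 2"
    unfolding winner_def f_def[symmetric] using sd
    by (intro pmf_tmax_pair assms(3,5,7) sd) (unfold f_def, intro set_pmf_tmax_pair)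
  also have "\<dots> = (q x * (1 + g x) * (1 + g x) + q x * (1 + (g x + gain X T (\<lambda>m. q m * g m) x))) / 2"
    by (simp only: f[OF assms(7)] gf d g_def[symmetric])
  also have "\<dots> = q x * (1 + 3 / 2 * g x + (g x)\<^sup>2 / 2 + gain X T (\<lambda>m. q m * g m) x / 2)"
    by (simp add: field_simps power2_eq_square)
  finally show ?thesis .
qed

lemma abs_gain_le_1:
  assumes "q \<in> distributions X"
  shows "\<bar>gain X T q x\<bar> \<le> 1"
proof -
  have "\<bar>gain X T q x\<bar> \<le> (\<Sum>y\<in>X. \<bar>payoff T x y * q y\<bar>)" unfolding gain_def by (rule sum_abs)
  also have "\<dots> \<le> (\<Sum>y\<in>X. q y)"
    using assms by (intro sum_mono) (auto simp: distributions_def payoff_def)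
  finally show ?thesis using assms by (simp add: distributions_def)
qed

section \<open>Drift of the relative entropy\<close>

text \<open>To first order, a lower bound for the expected increase of \<open>\<Sum>x. p x * ln (q x)\<close>, per added ball and in units of
  one over the number of balls, when the urn has composition \<open>q\<close>; see \<open>relative_growth_ge\<close>.\<close>

definition drift_bound :: "'a set \<Rightarrow> ('a \<Rightarrow> 'a \<Rightarrow> bool) \<Rightarrow> ('a \<Rightarrow> real) \<Rightarrow> ('a \<Rightarrow> real) \<Rightarrow> real" where
  "drift_bound X T p q = mixed_payoff X T p q + (\<Sum>x\<in>X. p x * (gain X T q x)\<^sup>2) / 2"

lemma drift_bound_nonneg:
  assumes "optimal_strategy X T p" "q \<in> distributions X"
  shows "0 \<le> drift_bound X T p q"
  using assms unfolding drift_bound_def optimal_strategy_def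
  by (intro add_nonneg_nonneg divide_nonneg_nonneg sum_nonneg) (auto simp: distributions_def)

text \<open>The vanishing of the first term confines \<open>q\<close> to the support of \<open>p\<close>, by strict complementarity;
  the vanishing of the second makes \<open>q\<close> a kernel vector there. The quadratic term is what two
  alternatives fail to provide, and the reason why three of them force convergence.\<close>

lemma drift_bound_zero:
  assumes "finite X" "tournament X T" "optimal_strategy X T p" "q \<in> distributions X"
    and "drift_bound X T p q \<le> 0" and "x \<in> X"
  shows "q x = p x"
proof (rule optimal_unique_on_support[OF assms(1-4) _ _ assms(6)])
  have dist: "\<And>x. x \<in> X \<Longrightarrow> 0 \<le> p x" "\<And>x. x \<in> X \<Longrightarrow> 0 \<le> q x"
    using assms(3,4) by (auto simp: optimal_strategy_def distributions_def)
  have mp: "0 \<le> mixed_payoff X T p q" using assms(3,4) by (simp add: optimal_strategy_def)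
  have sq: "0 \<le> (\<Sum>x\<in>X. p x * (gain X T q x)\<^sup>2)" using dist by (intro sum_nonneg) auto
  have z: "mixed_payoff X T p q = 0" "(\<Sum>x\<in>X. p x * (gain X T q x)\<^sup>2) = 0"
    using mp sq assms(5) by (auto simp: drift_bound_def)
  have "\<forall>x\<in>X. p x * (gain X T q x)\<^sup>2 = 0"
    using z(2) dist assms(1) by (subst (asm) sum_nonneg_eq_0_iff) auto
  then show "gain X T q x = 0" if "x \<in> X" "p x > 0" for x using that by auto
  have "(\<Sum>x\<in>X. q x * - gain X T p x) = 0"
    using z(1) mixed_payoff_antisym[OF assms(2), of p q] by (simp add: mixed_payoff_eq_gain sum_negf)
  then have "\<forall>x\<in>X. q x * - gain X T p x = 0"
    using dist assms(1) optimal_gain_nonpos[OF assms(1-3)]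
    by (subst (asm) sum_nonneg_eq_0_iff) (auto simp: mult_nonneg_nonpos)
  then show "q x = 0" if "x \<in> X" "p x = 0" for x
    using that optimal_strict_complementarity[OF assms(1-3), of x] by auto
qed

text \<open>In the \<open>p\<close>-average of the growth rates from \<open>pmf_winner\<close>, the linear term contributes
  \<open>3 / 2 * mixed_payoff X T p q\<close>. The last term is half of the payoff of \<open>p\<close> against the weights
  \<open>q m * g m\<close>; as \<open>g \<ge> - 1\<close> and \<open>p\<close> never loses, it costs at most half of \<open>mixed_payoff X T p q\<close>.\<close>

lemma relative_growth_ge:
  fixes X :: "'a set" and n :: "'a \<Rightarrow> nat"
  defines "q \<equiv> composition X n"
  assumes "finite X" "X \<noteq> {}" "tournament X T" "optimal_strategy X T p" "n \<in> urns X"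
  shows "(\<Sum>x\<in>X. p x * (pmf (winner X T n) x / q x)) \<ge> 1 + drift_bound X T p q"
proof -
  define g where "g = gain X T q"
  let ?h = "\<lambda>m. q m * g m"
  have qd: "q \<in> distributions X"
    unfolding q_def by (rule composition_in_distributions[OF assms(2,3,6)])
  have qpos: "q x > 0" if "x \<in> X" for x
    using assms(2,6) that by (auto simp: q_def composition_def urns_def intro!: divide_pos_pos sum_pos)
  have p: "\<And>x. x \<in> X \<Longrightarrow> 0 \<le> p x" "sum p X = 1"
    using assms by (auto simp: optimal_strategy_def distributions_def)
  have "mixed_payoff X T p ?h = - mixed_payoff X T ?h p" by (rule mixed_payoff_antisym) fact
  also have "\<dots> = (\<Sum>m\<in>X. q m * - gain X T p m * g m)"
    by (simp add: mixed_payoff_eq_gain sum_negf mult_ac)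
  also have "\<dots> \<ge> (\<Sum>m\<in>X. q m * - gain X T p m * - 1)"
  proof (intro sum_mono mult_left_mono)
    show "- 1 \<le> g m" for m using abs_gain_le_1[OF qd, of T m] by (simp add: g_def)
    show "0 \<le> q m * - gain X T p m" if "m \<in> X" for m
      using qpos[OF that] optimal_gain_nonpos[OF assms(2,4,5) that] by (simp add: mult_nonneg_nonpos)
  qed
  also have "(\<Sum>m\<in>X. q m * - gain X T p m * - 1) = mixed_payoff X T q p"
    by (simp add: mixed_payoff_eq_gain)
  also have "\<dots> = - mixed_payoff X T p q" by (rule mixed_payoff_antisym) fact
  finally have third: "mixed_payoff X T p ?h \<ge> - mixed_payoff X T p q" .
  have "(\<Sum>x\<in>X. p x * (pmf (winner X T n) x / q x))
      = (\<Sum>x\<in>X. p x + 3 / 2 * (p x * g x) + (p x * (g x)\<^sup>2) / 2 + p x * gain X T ?h x / 2)"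
  proof (intro sum.cong refl)
    fix x assume x: "x \<in> X"
    show "p x * (pmf (winner X T n) x / q x)
        = p x + 3 / 2 * (p x * g x) + (p x * (g x)\<^sup>2) / 2 + p x * gain X T ?h x / 2"
    proof -
      have "pmf (winner X T n) x / q x = 1 + 3 / 2 * g x + (g x)\<^sup>2 / 2 + gain X T ?h x / 2"
        using qpos[OF x]
        by (simp add: pmf_winner[OF assms(2,3,4,6) x] q_def[symmetric] g_def[symmetric])
      then show ?thesis by (simp only: distrib_left mult_1_right times_divide_eq_right mult.left_commute[of "p x" "3 / 2"])
    qed
  qed
  also have "\<dots> = 1 + 3 / 2 * mixed_payoff X T p q + (\<Sum>x\<in>X. p x * (g x)\<^sup>2) / 2
      + mixed_payoff X T p ?h / 2"
    by (simp add: sum.distrib p(2) mixed_payoff_eq_gain g_def[symmetric] sum_distrib_left sum_divide_distrib)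
  also have "\<dots> \<ge> 1 + drift_bound X T p q"
    using third by (simp add: drift_bound_def g_def)
  finally show ?thesis .
qed

text \<open>Up to constants and vanishing errors this is the relative entropy of \<open>p\<close> with respect to the urn
  composition. Harmonic numbers shifted by one replace the logarithms since
  \<open>harm n - harm (n - 1) = 1 / n\<close> holds exactly: an added ball then changes the potential by
  first-order terms only, and no second-order error has to be summed along the trajectory.\<close>

definition potential :: "'a set \<Rightarrow> ('a \<Rightarrow> real) \<Rightarrow> ('a \<Rightarrow> nat) \<Rightarrow> real" where
  "potential X p n = harm (sum n X - 1) - (\<Sum>x\<in>X. p x * harm (n x - 1))"

lemma urn_total_pos:
  assumes "finite X" "X \<noteq> {}" "n \<in> urns X"
  shows "sum n X > 0"
  using assms by (intro sum_pos) (auto simp: urns_def)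

lemma harm_pred: "m > 0 \<Longrightarrow> harm m = harm (m - 1) + 1 / real m"
  using harm_Suc[of "m - 1", where ?'a=real] by (simp add: inverse_eq_divide)

lemma sum_add_ball:
  assumes "finite X" "x \<in> X"
  shows "sum (n(x := n x + 1)) X = sum n X + (1::nat)"
proof -
  have "sum (n(x := n x + 1)) (X - {x}) = sum n (X - {x})" by (intro sum.cong) auto
  then show ?thesis using assms by (simp add: sum.remove)
qed

lemma potential_add_ball:
  assumes "finite X" "X \<noteq> {}" "n \<in> urns X" "x \<in> X"
  shows "potential X p (n(x := n x + 1)) = potential X p n + 1 / real (sum n X) - p x / real (n x)"
proof -
  let ?n = "n(x := n x + 1)"
  have "n x > 0" using assms by (auto simp: urns_def)
  then have "(\<Sum>y\<in>X. p y * harm (?n y - 1)) = (\<Sum>y\<in>X. p y * harm (n y - 1)) + p x / real (n x)"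
    using assms(1,4) harm_pred[of "n x"]
    by (simp add: sum.remove[of _ x] algebra_simps)
  moreover have "harm (sum ?n X - 1) = harm (sum n X - 1) + 1 / real (sum n X)"
    using harm_pred[OF urn_total_pos[OF assms(1-3)]] sum_add_ball[OF assms(1,4), of n] by simp
  ultimately show ?thesis by (simp add: potential_def)
qed

lemma expectation_step:
  fixes F :: "('a \<Rightarrow> nat) \<Rightarrow> real"
  assumes "finite X" "X \<noteq> {}" "n \<in> urns X"
  shows "measure_pmf.expectation (three_alternatives_step X T n) F
    = (\<Sum>x\<in>X. pmf (winner X T n) x * F (n(x := n x + 1)))"
  unfolding three_alternatives_step_eq
  using set_pmf_winner[OF assms] assms(1)
  by (simp, subst integral_measure_pmf[of X]) (auto simp: mult_ac)

lemma expectation_potential_le: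
  assumes "finite X" "X \<noteq> {}" "tournament X T" "optimal_strategy X T p" "n \<in> urns X"
  shows "measure_pmf.expectation (three_alternatives_step X T n) (potential X p)
    \<le> potential X p n - drift_bound X T p (composition X n) / real (sum n X)"
proof -
  let ?N = "real (sum n X)" and ?w = "pmf (winner X T n)" and ?q = "composition X n"
  have N: "?N > 0" by (simp only: of_nat_0_less_iff urn_total_pos[OF assms(1,2,5)])
  have one: "(\<Sum>x\<in>X. ?w x) = 1"
    using set_pmf_winner[OF assms(1,2,5)] assms(1) by (intro sum_pmf_eq_1)
  have "measure_pmf.expectation (three_alternatives_step X T n) (potential X p)
      = (\<Sum>x\<in>X. ?w x * (potential X p n + 1 / ?N) - p x * (?w x / ?q x) / ?N)"
    unfolding expectation_step[OF assms(1,2,5)]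
  proof (intro sum.cong refl)
    fix x assume x: "x \<in> X"
    have "?w x * (p x / real (n x)) = p x * (?w x / ?q x) / ?N"
      using N by (simp add: composition_def)
    then show "?w x * potential X p (n(x := n x + 1))
        = ?w x * (potential X p n + 1 / ?N) - p x * (?w x / ?q x) / ?N"
      unfolding potential_add_ball[OF assms(1,2,5) x] by (simp only: right_diff_distrib)
  qed
  also have "\<dots> = potential X p n + 1 / ?N - (\<Sum>x\<in>X. p x * (?w x / ?q x)) / ?N"
    unfolding sum_subtractf sum_distrib_right[symmetric] one sum_divide_distrib[symmetric] by simp
  also have "\<dots> \<le> potential X p n + 1 / ?N - (1 + drift_bound X T p ?q) / ?N"
    using relative_growth_ge[OF assms] N by (intro diff_left_mono divide_right_mono) auto
  finally show ?thesis by (simp add: add_divide_distrib)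
qed

lemma potential_nonneg:
  assumes "finite X" "p \<in> distributions X"
  shows "0 \<le> potential X p n"
proof -
  have "(\<Sum>x\<in>X. p x * harm (n x - 1)) \<le> (\<Sum>x\<in>X. p x * harm (sum n X - 1))"
    using assms by (intro sum_mono mult_left_mono harm_mono diff_le_mono member_le_sum)
      (auto simp: distributions_def)
  also have "\<dots> = harm (sum n X - 1)"
    using assms by (simp add: sum_distrib_right[symmetric] distributions_def)
  finally show ?thesis by (simp add: potential_def)
qed

section \<open>Maximal inequalities for paths of a Markov chain\<close>

text \<open>The law of the \<open>k\<close> states that follow the state \<open>s\<close>. The recursion peels off the first step, so that
  bounds valid for all starting states are proved by induction on the horizon.\<close>

primrec path_pmf :: "('s \<Rightarrow> 's pmf) \<Rightarrow> nat \<Rightarrow> 's \<Rightarrow> 's list pmf" where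
  "path_pmf K 0 s = return_pmf []"
| "path_pmf K (Suc k) s = bind_pmf (K s) (\<lambda>s'. map_pmf ((#) s') (path_pmf K k s'))"

lemma pmf_path_Cons:
  "pmf (path_pmf K (Suc k) s) (a # l) = pmf (K s) a * pmf (path_pmf K k a) l"
proof -
  have "pmf (path_pmf K (Suc k) s) (a # l)
      = (\<integral>x. pmf (map_pmf ((#) x) (path_pmf K k x)) (a # l) \<partial>K s)"
    by (simp add: pmf_bind)
  also have "\<dots> = (\<integral>x. indicator {a} x * pmf (path_pmf K k a) l \<partial>K s)"
  proof (rule Bochner_Integration.integral_cong[OF refl])
    fix x
    show "pmf (map_pmf ((#) x) (path_pmf K k x)) (a # l) = indicator {a} x * pmf (path_pmf K k a) l"
    proof (cases "x = a")
      case True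
      then show ?thesis by (simp add: pmf_map_inj')
    next
      case False
      then have "a # l \<notin> set_pmf (map_pmf ((#) x) (path_pmf K k x))" by auto
      then show ?thesis using False by (simp add: pmf_eq_0_set_pmf)
    qed
  qed
  also have "\<dots> = pmf (K s) a * pmf (path_pmf K k a) l"
    by (simp add: pmf.rep_eq)
  finally show ?thesis .
qed

lemma pmf_path_snoc:
  assumes "length l = k"
  shows "pmf (path_pmf K (Suc k) s) (l @ [a]) = pmf (path_pmf K k s) l * pmf (K (last (s # l))) a"
  using assms
proof (induction l arbitrary: k s)
  case Nil
  then show ?case using pmf_path_Cons[of K 0 s a "[]"] by simp
next
  case (Cons b l)
  then obtain j where "k = Suc j" "length l = j" by auto
  then show ?case using Cons.IH[of j b] by (simp add: pmf_path_Cons del: path_pmf.simps)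
qed

lemma set_path_pmf:
  assumes "\<And>s. s \<in> S \<Longrightarrow> set_pmf (K s) \<subseteq> S" "s \<in> S"
  shows "set_pmf (path_pmf K k s) \<subseteq> {l. length l = k \<and> set l \<subseteq> S}"
  using assms(2)
proof (induction k arbitrary: s)
  case (Suc k)
  then show ?case using assms(1) by fastforce
qed simp

lemma path_prob_Suc:
  "measure (path_pmf K (Suc k) s) A
    = (\<integral>s'. measure (path_pmf K k s') {l. s' # l \<in> A} \<partial>K s)"
proof -
  have "ennreal (measure (path_pmf K (Suc k) s) A)
      = (\<integral>\<^sup>+s'. ennreal (measure (path_pmf K k s') {l. s' # l \<in> A}) \<partial>K s)"
    by (simp add: measure_pmf.emeasure_eq_measure[symmetric] vimage_def)
  also have "\<dots> = ennreal (\<integral>s'. measure (path_pmf K k s') {l. s' # l \<in> A} \<partial>K s)"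
    by (intro nn_integral_eq_integral measure_pmf.integrable_const_bound[where B=1]) auto
  finally show ?thesis
    by (subst (asm) ennreal_inj) (auto intro!: integral_nonneg_AE)
qed

lemma path_prob_0: "measure (path_pmf K 0 s) A = of_bool ([] \<in> A)"
  by (simp add: indicator_def)

lemma expectation_pmf_mono:
  fixes f g :: "'s \<Rightarrow> real"
  assumes "finite (set_pmf p)" "\<And>s. s \<in> set_pmf p \<Longrightarrow> f s \<le> g s"
  shows "measure_pmf.expectation p f \<le> measure_pmf.expectation p g"
  using assms by (intro integral_mono_AE integrable_measure_pmf_finite) (auto simp: AE_measure_pmf_iff)

text \<open>The values \<open>d\<close> collected along a path have expectation at most \<open>V s\<close>, because \<open>V\<close> pays for them
  and stays nonnegative, so this is a Markov inequality. It is proved directly by induction: after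
  one step the threshold is \<open>c - d s\<close> and the expected budget is at most \<open>V s - d s\<close>, and
  \<open>(V s - d s) / (c - d s) \<le> V s / c\<close> as long as \<open>V s < c\<close>.\<close>

lemma path_prob_occupation:
  fixes V d :: "'s \<Rightarrow> real"
  assumes closed: "\<And>s. s \<in> S \<Longrightarrow> set_pmf (K s) \<subseteq> S"
    and fin: "\<And>s. s \<in> S \<Longrightarrow> finite (set_pmf (K s))"
    and V: "\<And>s. s \<in> S \<Longrightarrow> 0 \<le> V s" and d: "\<And>s. s \<in> S \<Longrightarrow> 0 \<le> d s"
    and drift: "\<And>s. s \<in> S \<Longrightarrow> measure_pmf.expectation (K s) V \<le> V s - d s"
    and "s \<in> S" "c > 0"
  shows "measure (path_pmf K k s) {l. sum_list (map d (s # l)) \<ge> c} \<le> V s / c"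
  using assms(6,7)
proof (induction k arbitrary: s c)
  case (0 s c)
  have "0 \<le> measure_pmf.expectation (K s) V"
    using V closed[OF 0(1)] by (intro integral_nonneg_AE) (auto simp: AE_measure_pmf_iff)
  then have "d s \<le> V s" using drift[OF 0(1)] by linarith
  then show ?case using 0 V[OF 0(1)] by (auto simp: path_prob_0 simp del: path_pmf.simps)
next
  case (Suc k s c)
  note s = Suc.prems(1) and c = Suc.prems(2)
  have E0: "0 \<le> measure_pmf.expectation (K s) V"
    using V closed[OF s] by (intro integral_nonneg_AE) (auto simp: AE_measure_pmf_iff)
  show ?case
  proof (cases "V s < c")
    case False
    then have "1 \<le> V s / c" using c by simp
    then show ?thesis using measure_pmf.prob_le_1 order_trans by blast
  next
    case True
    have dc: "d s \<le> V s" using E0 drift[OF s] by linarith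
    then have c': "c - d s > 0" using True by linarith
    have "measure (path_pmf K (Suc k) s) {l. sum_list (map d (s # l)) \<ge> c}
        = (\<integral>s'. measure (path_pmf K k s') {l. sum_list (map d (s' # l)) \<ge> c - d s} \<partial>K s)"
      unfolding path_prob_Suc by (simp add: algebra_simps)
    also have "\<dots> \<le> (\<integral>s'. V s' / (c - d s) \<partial>K s)"
      using Suc.IH[OF _ c'] closed[OF s] fin[OF s] by (intro expectation_pmf_mono) auto
    also have "\<dots> \<le> (V s - d s) / (c - d s)"
      using drift[OF s] c' by (simp add: divide_right_mono)
    also have "\<dots> \<le> V s / c"
    proof -
      have "V s * d s \<le> c * d s" using True d[OF s] by (intro mult_right_mono) auto
      then show ?thesis using c c' by (simp add: frac_le_eq divide_le_0_iff field_simps)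
    qed
    finally show ?thesis .
  qed
qed

text \<open>The path is in \<open>A\<close> at some time and in \<open>B\<close> at the same or a later time.\<close>

primrec crosses :: "'s set \<Rightarrow> 's set \<Rightarrow> 's list \<Rightarrow> bool" where
  "crosses A B [] \<longleftrightarrow> False"
| "crosses A B (s # l) \<longleftrightarrow> (s \<in> A \<and> (\<exists>s'\<in>set (s # l). s' \<in> B)) \<or> crosses A B l"

lemma crosses_append: "crosses A B l \<Longrightarrow> crosses A B (l @ l')"
  by (induction l) auto

lemma crosses_hits: "crosses A B l \<Longrightarrow> \<exists>s\<in>set l. s \<in> B"
  by (induction l) auto

lemma crosses_nth: "i \<le> j \<Longrightarrow> j < length l \<Longrightarrow> l ! i \<in> A \<Longrightarrow> l ! j \<in> B \<Longrightarrow> crosses A B l"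
proof (induction l arbitrary: i j)
  case (Cons s l)
  show ?case
  proof (cases i)
    case 0
    then show ?thesis using Cons.prems nth_mem[of j "s # l"] by auto
  next
    case (Suc i')
    then obtain j' where "j = Suc j'" using Cons.prems by (cases j) auto
    then show ?thesis using Cons Suc by auto
  qed
qed simp

text \<open>The maximal inequality for nonnegative supermartingales.\<close>

lemma path_prob_hits:
  fixes V :: "'s \<Rightarrow> real"
  assumes closed: "\<And>s. s \<in> C \<Longrightarrow> set_pmf (K s) \<subseteq> C"
    and fin: "\<And>s. s \<in> C \<Longrightarrow> finite (set_pmf (K s))"
    and V: "\<And>s. s \<in> C \<Longrightarrow> 0 \<le> V s"
    and super: "\<And>s. s \<in> C \<Longrightarrow> measure_pmf.expectation (K s) V \<le> V s"
    and B: "\<And>s. s \<in> B \<Longrightarrow> s \<in> C \<Longrightarrow> \<delta> \<le> V s" and "\<delta> > 0" and "s \<in> C"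
  shows "measure (path_pmf K k s) {l. \<exists>s'\<in>set (s # l). s' \<in> B} \<le> V s / \<delta>"
  using assms(7)
proof (induction k arbitrary: s)
  case (0 s)
  then show ?case using V[OF 0] B[OF _ 0] \<open>\<delta> > 0\<close>
    by (auto simp: path_prob_0 simp del: path_pmf.simps)
next
  case (Suc k s)
  show ?case
  proof (cases "s \<in> B")
    case True
    then have "1 \<le> V s / \<delta>" using B Suc.prems \<open>\<delta> > 0\<close> by simp
    then show ?thesis using measure_pmf.prob_le_1 order_trans by blast
  next
    case False
    then have "measure (path_pmf K (Suc k) s) {l. \<exists>s'\<in>set (s # l). s' \<in> B}
        = (\<integral>s'. measure (path_pmf K k s') {l. \<exists>s''\<in>set (s' # l). s'' \<in> B} \<partial>K s)"
      unfolding path_prob_Suc by simp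
    also have "\<dots> \<le> (\<integral>s'. V s' / \<delta> \<partial>K s)"
      using Suc closed fin by (intro expectation_pmf_mono) blast+
    also have "\<dots> \<le> V s / \<delta>"
      using super[OF Suc.prems] \<open>\<delta> > 0\<close> by (simp add: divide_right_mono)
    finally show ?thesis .
  qed
qed

text \<open>The maximal inequality restarted at the first visit to \<open>A\<close>, where \<open>V\<close> is at most \<open>\<epsilon>\<close>. Only the closed
  set \<open>C\<close> matters because nothing is at stake before that visit; this is what allows \<open>V\<close> to be
  nonnegative only late in the process.\<close>

lemma path_prob_crosses:
  fixes V :: "'s \<Rightarrow> real"
  assumes closed: "\<And>s. s \<in> S \<Longrightarrow> set_pmf (K s) \<subseteq> S"
    and fin: "\<And>s. s \<in> S \<Longrightarrow> finite (set_pmf (K s))"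
    and C: "C \<subseteq> S" "\<And>s. s \<in> C \<Longrightarrow> set_pmf (K s) \<subseteq> C"
    and V: "\<And>s. s \<in> C \<Longrightarrow> 0 \<le> V s"
    and super: "\<And>s. s \<in> C \<Longrightarrow> measure_pmf.expectation (K s) V \<le> V s"
    and A: "A \<subseteq> C" "\<And>s. s \<in> A \<Longrightarrow> V s \<le> \<epsilon>"
    and B: "\<And>s. s \<in> B \<Longrightarrow> s \<in> C \<Longrightarrow> \<delta> \<le> V s" and "\<delta> > 0" "\<epsilon> \<ge> 0" and "s \<in> S"
  shows "measure (path_pmf K k s) {l. crosses A B (s # l)} \<le> \<epsilon> / \<delta>"
  using assms(12)
proof (induction k arbitrary: s)
  have hit: "measure (path_pmf K k s) {l. crosses A B (s # l)} \<le> \<epsilon> / \<delta>" if "s \<in> A" for k s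
  proof -
    have "measure (path_pmf K k s) {l. crosses A B (s # l)}
        \<le> measure (path_pmf K k s) {l. \<exists>s'\<in>set (s # l). s' \<in> B}"
      by (intro measure_pmf.finite_measure_mono) (auto dest: crosses_hits)
    also have "\<dots> \<le> V s / \<delta>"
      using that C A B V super fin \<open>\<delta> > 0\<close> by (intro path_prob_hits[where C=C]) auto
    also have "\<dots> \<le> \<epsilon> / \<delta>" using A(2)[OF that] \<open>\<delta> > 0\<close> by (simp add: divide_right_mono)
    finally show ?thesis .
  qed
  {
    case (0 s)
    show ?case
    proof (cases "s \<in> A")
      case False
      then show ?thesis using \<open>\<delta> > 0\<close> \<open>\<epsilon> \<ge> 0\<close> by simp
    qed (rule hit)
  next
    case (Suc k s)
    show ?case
    proof (cases "s \<in> A")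
      case False
      then have "measure (path_pmf K (Suc k) s) {l. crosses A B (s # l)}
          = (\<integral>s'. measure (path_pmf K k s') {l. crosses A B (s' # l)} \<partial>K s)"
        unfolding path_prob_Suc by simp
      also have "\<dots> \<le> (\<integral>s'. \<epsilon> / \<delta> \<partial>K s)"
        using Suc closed fin by (intro expectation_pmf_mono) blast+
      finally show ?thesis by simp
    qed (rule hit)
  }
qed

section \<open>Almost sure behaviour of Markov chains\<close>

text \<open>The initial state is left out, to match \<open>path_pmf\<close>.\<close>

definition history :: "(nat \<Rightarrow> 'w \<Rightarrow> 's) \<Rightarrow> nat \<Rightarrow> 'w \<Rightarrow> 's list" where
  "history N k \<omega> = map (\<lambda>i. N (Suc i) \<omega>) [0..<k]"

lemma Cons_history: "N 0 \<omega> # history N k \<omega> = map (\<lambda>i. N i \<omega>) [0..<Suc k]"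
  unfolding history_def by (rule nth_equalityI) (auto simp: nth_Cons' simp del: upt_Suc)

lemma measurable_history:
  assumes "\<And>t. N t \<in> M \<rightarrow>\<^sub>M count_space S" "countable S"
  shows "history N k \<in> M \<rightarrow>\<^sub>M count_space UNIV"
proof -
  have fib: "{\<omega> \<in> space M. history N k \<omega> = l} \<in> sets M" for l
  proof -
    have "{\<omega> \<in> space M. N t \<omega> = s} \<in> sets M" for t s
    proof -
      have "{\<omega> \<in> space M. N t \<omega> = s} = N t -` ({s} \<inter> S) \<inter> space M"
        using measurable_space[OF assms(1), of _ t] by auto
      then show ?thesis using measurable_sets[OF assms(1)[of t], of "{s} \<inter> S"] by auto
    qed
    moreover have "{\<omega> \<in> space M. history N k \<omega> = l}
        = {\<omega> \<in> space M. length l = k \<and> (\<forall>i<k. N (Suc i) \<omega> = l ! i)}"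
      by (auto simp: history_def list_eq_iff_nth_eq)
    ultimately show ?thesis by (auto intro!: sets.sets_Collect sets.sets_Collect_finite_All)
  qed
  have "history N k \<in> M \<rightarrow>\<^sub>M count_space (lists S)"
  proof (subst measurable_count_space_eq_countable[OF countable_lists[OF assms(2)]], intro conjI ballI)
    show "history N k \<in> space M \<rightarrow> lists S"
      using measurable_space[OF assms(1)] by (auto simp: history_def)
    show "history N k -` {l} \<inter> space M \<in> sets M" for l
      using fib[of l] by (simp add: vimage_def Int_def conj_commute)
  qed
  then show ?thesis by (rule measurable_compose) simp
qed

lemma (in prob_space) prob_history:
  assumes mc: "markov_chain M S K N" and "countable S" and N0: "AE \<omega> in M. N 0 \<omega> = s0"
  shows "prob {\<omega> \<in> space M. N 0 \<omega> = s0 \<and> history N k \<omega> = l} = pmf (path_pmf K k s0) l"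
proof (cases "length l = k")
  case False
  have "set_pmf (path_pmf K k s0) \<subseteq> {l. length l = k \<and> set l \<subseteq> UNIV}"
    by (rule set_path_pmf) auto
  then have "pmf (path_pmf K k s0) l = 0" using False by (auto simp: pmf_eq_0_set_pmf)
  moreover have "{\<omega> \<in> space M. N 0 \<omega> = s0 \<and> history N k \<omega> = l} = {}"
    using False by (auto simp: history_def)
  ultimately show ?thesis by (simp only: measure_empty)
next
  case True
  have meas: "\<And>t. N t \<in> M \<rightarrow>\<^sub>M count_space S"
    using mc by (simp add: markov_chain_def)
  have ev: "{\<omega> \<in> space M. N t \<omega> = s} \<in> events" for t s
  proof -
    have "{\<omega> \<in> space M. N t \<omega> = s} = N t -` ({s} \<inter> S) \<inter> space M"
      using measurable_space[OF meas, of _ t] by auto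
    then show ?thesis using measurable_sets[OF meas[of t], of "{s} \<inter> S"] by auto
  qed
  have hist: "N 0 \<omega> = s0 \<and> history N (length l) \<omega> = l \<longleftrightarrow> (\<forall>i\<le>length l. N i \<omega> = (s0 # l) ! i)" for l \<omega>
  proof -
    have "(\<forall>i\<le>length l. N i \<omega> = (s0 # l) ! i)
        \<longleftrightarrow> N 0 \<omega> = s0 \<and> (\<forall>i<length l. N (Suc i) \<omega> = l ! i)"
      by (simp only: less_Suc_eq_le[symmetric] All_less_Suc2 nth_Cons_0 nth_Cons_Suc)
    moreover have "history N (length l) \<omega> = l \<longleftrightarrow> (\<forall>i<length l. N (Suc i) \<omega> = l ! i)"
      unfolding history_def by (subst list_eq_iff_nth_eq) simp
    ultimately show ?thesis by blast
  qed
  have "prob {\<omega> \<in> space M. N 0 \<omega> = s0 \<and> history N (length l) \<omega> = l}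
      = pmf (path_pmf K (length l) s0) l"
  proof (induction l rule: rev_induct)
    case Nil
    have "prob {\<omega> \<in> space M. N 0 \<omega> = s0} = 1"
      using N0 ev by (subst prob_Collect_eq_1) auto
    then show ?case by (simp add: history_def)
  next
    case (snoc a l)
    let ?s = "\<lambda>i. (s0 # l) ! i" and ?k = "length l"
    let ?H = "{\<omega> \<in> space M. \<forall>i\<le>?k. N i \<omega> = ?s i}"
    have IH: "prob ?H = pmf (path_pmf K ?k s0) l" using snoc by (simp only: hist)
    have "N 0 \<omega> = s0 \<and> history N (Suc ?k) \<omega> = l @ [a]
        \<longleftrightarrow> N (Suc ?k) \<omega> = a \<and> (N 0 \<omega> = s0 \<and> history N ?k \<omega> = l)" for \<omega>
      by (auto simp: history_def)
    then have "prob {\<omega> \<in> space M. N 0 \<omega> = s0 \<and> history N (Suc ?k) \<omega> = l @ [a]}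
        = prob {\<omega> \<in> space M. N (Suc ?k) \<omega> = a \<and> (\<forall>i\<le>?k. N i \<omega> = ?s i)}"
      by (simp only: hist)
    also have "\<dots> = prob ?H * pmf (K (?s ?k)) a"
    proof (cases "prob ?H = 0")
      case True
      have "?H \<in> events" using ev by (auto intro!: sets.sets_Collect_finite_All)
      then have "prob {\<omega> \<in> space M. N (Suc ?k) \<omega> = a \<and> (\<forall>i\<le>?k. N i \<omega> = ?s i)} \<le> prob ?H"
        by (rule finite_measure_mono[rotated]) blast
      then show ?thesis using True by (simp add: measure_le_0_iff)
    next
      case False
      then have "0 < prob ?H" by (simp add: zero_less_measure_iff)
      then have "cond_prob M (\<lambda>\<omega>. N (Suc ?k) \<omega> = a) (\<lambda>\<omega>. \<forall>i\<le>?k. N i \<omega> = ?s i) = pmf (K (?s ?k)) a"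
        using mc by (auto simp: markov_chain_def)
      then show ?thesis using False by (simp add: cond_prob_def field_simps)
    qed
    also have "?s ?k = last (s0 # l)" by (simp add: last_conv_nth)
    also have "prob ?H * pmf (K (last (s0 # l))) a = pmf (path_pmf K (Suc ?k) s0) (l @ [a])"
      unfolding IH by (rule pmf_path_snoc[OF refl, symmetric])
    finally show ?case by (simp only: length_append_singleton)
  qed
  then show ?thesis using True by simp
qed

text \<open>Identifying the law of a finite stretch of the process with \<open>path_pmf\<close> transfers every bound proved
  for paths to the given probability space.\<close>

lemma (in prob_space) distr_history:
  assumes mc: "markov_chain M S K N" and "countable S" and N0: "AE \<omega> in M. N 0 \<omega> = s0"
    and closed: "\<And>s. s \<in> S \<Longrightarrow> set_pmf (K s) \<subseteq> S" and "s0 \<in> S"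
  shows "distr M (count_space UNIV) (history N k) = measure_pmf (path_pmf K k s0)"
proof (rule measure_eqI_countable_AE[where \<Omega> = "lists S"])
  have meas: "\<And>t. N t \<in> M \<rightarrow>\<^sub>M count_space S"
    using mc by (simp add: markov_chain_def)
  have H: "history N k \<in> M \<rightarrow>\<^sub>M count_space UNIV"
    by (rule measurable_history[OF meas assms(2)])
  show "countable (lists S)" using assms(2) by simp
  show "AE l in distr M (count_space UNIV) (history N k). l \<in> lists S"
    using measurable_space[OF meas] H
    by (subst AE_distr_iff) (auto simp: history_def intro!: AE_I2)
  show "AE l in measure_pmf (path_pmf K k s0). l \<in> lists S"
    using set_path_pmf[of S K, OF closed \<open>s0 \<in> S\<close>] by (auto simp: AE_measure_pmf_iff)
  fix l
  have "emeasure (distr M (count_space UNIV) (history N k)) {l}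
      = emeasure M {\<omega> \<in> space M. history N k \<omega> = l}"
    by (subst emeasure_distr[OF H]) (auto intro!: arg_cong[where f="emeasure M"])
  also have "\<dots> = emeasure M {\<omega> \<in> space M. N 0 \<omega> = s0 \<and> history N k \<omega> = l}"
  proof (rule emeasure_eq_AE)
    show E: "{\<omega> \<in> space M. history N k \<omega> = l} \<in> events"
      using measurable_sets[OF H, of "{l}"] by (simp add: vimage_def Int_def conj_commute)
    have "{\<omega> \<in> space M. N 0 \<omega> = s0} = N 0 -` {s0} \<inter> space M" by auto
    then have "{\<omega> \<in> space M. N 0 \<omega> = s0} \<in> events"
      using measurable_sets[OF meas[of 0], of "{s0}"] \<open>s0 \<in> S\<close> by auto
    then show "{\<omega> \<in> space M. N 0 \<omega> = s0 \<and> history N k \<omega> = l} \<in> events"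
      using E by (intro sets.sets_Collect_conj)
  qed (use N0 in auto)
  also have "\<dots> = emeasure (path_pmf K k s0) {l}"
    using prob_history[OF assms(1-3), of k l] by (simp add: emeasure_eq_measure emeasure_pmf_single)
  finally show "emeasure (distr M (count_space UNIV) (history N k)) {l}
      = emeasure (path_pmf K k s0) {l}" .
qed auto

lemma (in prob_space) AE_markov_invariant:
  assumes mc: "markov_chain M S K N" and "countable S" and N0: "AE \<omega> in M. N 0 \<omega> = s0"
    and closed: "\<And>s. s \<in> S \<Longrightarrow> set_pmf (K s) \<subseteq> S" and "s0 \<in> S"
    and R: "s0 \<in> R 0" "\<And>k s. s \<in> R k \<Longrightarrow> set_pmf (K s) \<subseteq> R (Suc k)"
  shows "AE \<omega> in M. \<forall>k. N k \<omega> \<in> R k"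
  unfolding AE_all_countable
proof
  fix k
  have path: "last (s # l) \<in> R (j + k)" if "s \<in> R j" "l \<in> set_pmf (path_pmf K k s)" for s l j k
    using that
  proof (induction k arbitrary: s l j)
    case (Suc k)
    then obtain s' l' where "s' \<in> set_pmf (K s)" "l' \<in> set_pmf (path_pmf K k s')" "l = s' # l'"
      by auto
    then show ?case using Suc.IH[of s' "Suc j" l'] R(2)[OF Suc.prems(1)] by auto
  qed simp
  have meas: "\<And>t. N t \<in> M \<rightarrow>\<^sub>M count_space S"
    using mc by (simp add: markov_chain_def)
  have H: "history N k \<in> M \<rightarrow>\<^sub>M count_space UNIV"
    by (rule measurable_history[OF meas assms(2)])
  have "AE l in path_pmf K k s0. last (s0 # l) \<in> R k"
    using path[OF R(1), of _ k] by (simp add: AE_measure_pmf_iff)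
  then have "AE l in distr M (count_space UNIV) (history N k). last (s0 # l) \<in> R k"
    by (simp only: distr_history[OF assms(1-5)])
  then have "AE \<omega> in M. last (s0 # history N k \<omega>) \<in> R k"
    by (rule AE_distrD[OF H])
  with N0 show "AE \<omega> in M. N k \<omega> \<in> R k"
  proof eventually_elim
    case (elim \<omega>)
    then have "last (N 0 \<omega> # history N k \<omega>) \<in> R k" by simp
    then show ?case unfolding Cons_history by simp
  qed
qed

text \<open>The bound must be uniform in the horizon; monotonicity of \<open>Q\<close> then turns the existence of a
  horizon into an increasing union.\<close>

lemma (in prob_space) prob_eventually_history_le:
  assumes mc: "markov_chain M S K N" and "countable S" and N0: "AE \<omega> in M. N 0 \<omega> = s0"
    and closed: "\<And>s. s \<in> S \<Longrightarrow> set_pmf (K s) \<subseteq> S" and "s0 \<in> S"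
    and mono: "\<And>l a. set l \<subseteq> S \<Longrightarrow> a \<in> S \<Longrightarrow> Q l \<Longrightarrow> Q (l @ [a])"
    and le: "\<And>k. measure (path_pmf K k s0) {l. Q l} \<le> r"
  shows "{\<omega> \<in> space M. \<exists>k. Q (history N k \<omega>)} \<in> events"
    and "prob {\<omega> \<in> space M. \<exists>k. Q (history N k \<omega>)} \<le> r"
proof -
  define E where "E k = {\<omega> \<in> space M. Q (history N k \<omega>)}" for k
  have meas: "\<And>t. N t \<in> M \<rightarrow>\<^sub>M count_space S"
    using mc by (simp add: markov_chain_def)
  have H: "history N k \<in> M \<rightarrow>\<^sub>M count_space UNIV" for k
    by (rule measurable_history[OF meas assms(2)])
  have E_vim: "E k = history N k -` {l. Q l} \<inter> space M" for k by (auto simp: E_def)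
  have ev: "E k \<in> events" for k unfolding E_vim by (rule measurable_sets[OF H]) simp
  have Un: "{\<omega> \<in> space M. \<exists>k. Q (history N k \<omega>)} = (\<Union>k. E k)" by (auto simp: E_def)
  then show "{\<omega> \<in> space M. \<exists>k. Q (history N k \<omega>)} \<in> events" using ev by auto
  have "E k \<subseteq> E (Suc k)" for k
  proof
    fix \<omega> assume \<omega>: "\<omega> \<in> E k"
    have N: "N i \<omega> \<in> S" for i using measurable_space[OF meas] \<omega> by (auto simp: E_def)
    have "Q (history N k \<omega> @ [N (Suc k) \<omega>])"
      using \<omega> N by (intro mono) (auto simp: E_def history_def)
    then show "\<omega> \<in> E (Suc k)" using \<omega> by (simp add: E_def history_def)
  qed
  then have "incseq E" by (rule incseq_SucI)
  then have "(\<lambda>k. prob (E k)) \<longlonglongrightarrow> prob (\<Union>k. E k)"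
    using ev by (intro finite_Lim_measure_incseq) auto
  moreover have "prob (E k) \<le> r" for k
  proof -
    have "prob (E k) = measure (distr M (count_space UNIV) (history N k)) {l. Q l}"
      unfolding E_vim by (rule measure_distr[symmetric, OF H]) simp
    then show ?thesis using le[of k] by (simp add: distr_history[OF assms(1-5)])
  qed
  ultimately have "prob (\<Union>k. E k) \<le> r" by (intro LIMSEQ_le_const2) auto
  then show "prob {\<omega> \<in> space M. \<exists>k. Q (history N k \<omega>)} \<le> r" by (simp add: Un)
qed

lemma (in prob_space) AE_not_all_small:
  assumes "\<And>i. E i \<in> events" "\<And>i. prob (E i) \<le> r i" "r \<longlonglongrightarrow> (0::real)"
  shows "AE \<omega> in M. \<exists>i::nat. \<omega> \<notin> E i"
proof -
  have "prob (\<Inter>i. E i) \<le> r i" for i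
    by (rule order_trans[OF finite_measure_mono assms(2)]) (use assms(1) in auto)
  then have "prob (\<Inter>i. E i) \<le> 0" using assms(3) by (intro LIMSEQ_le_const) auto
  then have "(\<Inter>i. E i) \<in> null_sets M"
    using assms(1) by (intro null_setsI) (auto simp: emeasure_eq_measure measure_le_0_iff)
  then show ?thesis by (rule AE_I') auto
qed

theorem (in prob_space) AE_bounded_occupation:
  fixes V d :: "'s \<Rightarrow> real"
  assumes mc: "markov_chain M S K N" and "countable S" and N0: "AE \<omega> in M. N 0 \<omega> = s0"
    and closed: "\<And>s. s \<in> S \<Longrightarrow> set_pmf (K s) \<subseteq> S" and "s0 \<in> S"
    and fin: "\<And>s. s \<in> S \<Longrightarrow> finite (set_pmf (K s))"
    and V: "\<And>s. s \<in> S \<Longrightarrow> 0 \<le> V s" and d: "\<And>s. s \<in> S \<Longrightarrow> 0 \<le> d s"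
    and drift: "\<And>s. s \<in> S \<Longrightarrow> measure_pmf.expectation (K s) V \<le> V s - d s"
  shows "AE \<omega> in M. \<exists>c. \<forall>k. (\<Sum>i\<le>k. d (N i \<omega>)) < c"
proof -
  let ?Q = "\<lambda>c l. sum_list (map d (s0 # l)) \<ge> real (Suc c)"
  define E where "E c = {\<omega> \<in> space M. \<exists>k. ?Q c (history N k \<omega>)}" for c
  have mono: "?Q c (l @ [a])" if "set l \<subseteq> S" "a \<in> S" "?Q c l" for c l a
    using d[OF that(2)] that(3) by simp
  have le: "measure (path_pmf K k s0) {l. ?Q c l} \<le> V s0 / real (Suc c)" for k c
    using assms by (intro path_prob_occupation) auto
  have "E c \<in> events" for c
    unfolding E_def by (rule prob_eventually_history_le(1)[where Q = "?Q c", OF assms(1-5) mono le])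
  moreover have "prob (E c) \<le> V s0 / real (Suc c)" for c
    unfolding E_def by (rule prob_eventually_history_le(2)[where Q = "?Q c", OF assms(1-5) mono le])
  moreover have "(\<lambda>c. V s0 / real (Suc c)) \<longlonglongrightarrow> 0"
    by (rule LIMSEQ_Suc[OF lim_const_over_n])
  ultimately have "AE \<omega> in M. \<exists>c. \<omega> \<notin> E c" by (rule AE_not_all_small)
  with N0 AE_space show ?thesis
  proof eventually_elim
    case (elim \<omega>)
    then obtain c where c: "\<omega> \<notin> E c" by auto
    have "(\<Sum>i\<le>k. d (N i \<omega>)) < real (Suc c)" for k
    proof -
      have "(\<Sum>i\<le>k. d (N i \<omega>)) = sum_list (map d (N 0 \<omega> # history N k \<omega>))"
        unfolding Cons_history by (simp add: interv_sum_list_conv_sum_set_nat atLeast0LessThan lessThan_Suc_atMost comp_def del: upt_Suc)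
      then show ?thesis using c elim by (auto simp: E_def not_le)
    qed
    then show ?case by blast
  qed
qed

text \<open>A substitute for the convergence theorem for supermartingales when the limit is known in advance.
  After a return to a value at most \<open>r j\<close> in \<open>C j\<close>, where \<open>V + r j\<close> is nonnegative, the maximal
  inequality gives probability at most \<open>2 * r j / \<delta>\<close> to ever reaching \<open>\<delta>\<close> again. Such returns are
  certain for every \<open>j\<close>, and \<open>r j\<close> tends to \<open>0\<close>.\<close>

theorem (in prob_space) AE_limsup_nonpos_of_returns:
  fixes V :: "'s \<Rightarrow> real" and C :: "nat \<Rightarrow> 's set"
  assumes mc: "markov_chain M S K N" and "countable S" and N0: "AE \<omega> in M. N 0 \<omega> = s0"
    and closed: "\<And>s. s \<in> S \<Longrightarrow> set_pmf (K s) \<subseteq> S" and "s0 \<in> S"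
    and fin: "\<And>s. s \<in> S \<Longrightarrow> finite (set_pmf (K s))"
    and super: "\<And>s. s \<in> S \<Longrightarrow> measure_pmf.expectation (K s) V \<le> V s"
    and C: "\<And>j. C j \<subseteq> S" "\<And>j s. s \<in> C j \<Longrightarrow> set_pmf (K s) \<subseteq> C j"
    and lower: "\<And>j s. s \<in> C j \<Longrightarrow> - r j \<le> V s" and r: "r \<longlonglongrightarrow> 0" "\<And>j. r j \<ge> 0"
    and returns: "AE \<omega> in M. \<forall>j. \<exists>t. N t \<omega> \<in> C j \<and> V (N t \<omega>) \<le> r j"
  shows "AE \<omega> in M. \<forall>\<delta>>0. eventually (\<lambda>t. V (N t \<omega>) < \<delta>) sequentially"
proof -
  have one: "AE \<omega> in M. eventually (\<lambda>t. V (N t \<omega>) < \<delta>) sequentially" if "\<delta> > 0" for \<delta>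
  proof -
    define A where "A j = {s \<in> C j. V s \<le> r j}" for j
    define B where "B = {s. V s \<ge> \<delta>}"
    define E where "E j = {\<omega> \<in> space M. \<exists>k. crosses (A j) B (s0 # history N k \<omega>)}" for j
    have le: "measure (path_pmf K k s0) {l. crosses (A j) B (s0 # l)} \<le> 2 * r j / \<delta>" for k j
    proof (rule path_prob_crosses[where S=S and C="C j" and V="\<lambda>s. V s + r j"])
      show "measure_pmf.expectation (K s) (\<lambda>s. V s + r j) \<le> V s + r j" if "s \<in> C j" for s
        using super[of s] C(1)[of j] that fin[of s]
        by (subst Bochner_Integration.integral_add) (auto intro!: integrable_measure_pmf_finite)
      show "0 \<le> V s + r j" if "s \<in> C j" for s using lower[OF that] by simp
    qed (use closed fin C r(2)[of j] that \<open>s0 \<in> S\<close> in \<open>auto simp: A_def B_def\<close>)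
    have mono: "crosses (A j) B (s0 # (l @ [a]))"
      if "set l \<subseteq> S" "a \<in> S" "crosses (A j) B (s0 # l)" for l a j
      using crosses_append[OF that(3), of "[a]"] by simp
    let ?Q = "\<lambda>j l. crosses (A j) B (s0 # l)"
    have "E j \<in> events" for j
      unfolding E_def by (rule prob_eventually_history_le(1)[where Q = "?Q j", OF assms(1-5) mono le])
    moreover have "prob (E j) \<le> 2 * r j / \<delta>" for j
      unfolding E_def by (rule prob_eventually_history_le(2)[where Q = "?Q j", OF assms(1-5) mono le])
    moreover have "(\<lambda>j. 2 * r j / \<delta>) \<longlonglongrightarrow> 0"
      using tendsto_mult_left[OF r(1), of "2 / \<delta>"] by (simp add: field_simps)
    ultimately have "AE \<omega> in M. \<exists>j. \<omega> \<notin> E j" by (rule AE_not_all_small)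
    with N0 AE_space returns show ?thesis
    proof eventually_elim
      case (elim \<omega>)
      then obtain j where j: "\<omega> \<notin> E j" by auto
      obtain t where t: "N t \<omega> \<in> A j" using elim(3) by (auto simp: A_def)
      have "V (N u \<omega>) < \<delta>" if "u \<ge> t" for u
      proof (rule ccontr)
        assume "\<not> V (N u \<omega>) < \<delta>"
        then have "crosses (A j) B (N 0 \<omega> # history N u \<omega>)"
          unfolding Cons_history
          using t that by (intro crosses_nth[of t u]) (auto simp: B_def simp del: upt_Suc)
        then show False using j elim(1,2) by (auto simp only: E_def mem_Collect_eq)
      qed
      then show ?case by (auto simp: eventually_sequentially)
    qed
  qed
  have "AE \<omega> in M. \<forall>i. eventually (\<lambda>t. V (N t \<omega>) < 1 / real (Suc i)) sequentially"
    unfolding AE_all_countable by (intro allI one) simp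
  then show ?thesis
  proof eventually_elim
    case (elim \<omega>)
    show ?case
    proof (intro allI impI)
      fix \<delta> :: real assume "\<delta> > 0"
      then obtain i where "1 / real (Suc i) < \<delta>" using nat_approx_posE by blast
      then show "eventually (\<lambda>t. V (N t \<omega>) < \<delta>) sequentially"
        using eventually_mono[OF elim[rule_format, of i]] by force
    qed
  qed
qed

section \<open>The potential as relative entropy\<close>

text \<open>The shift by one makes this sequence approach the Euler-Mascheroni constant from below. That is the
  sign needed in \<open>hellinger_le_entropy_gap\<close>, where the number of balls of a single colour
  need not be large.\<close>

definition harm_excess :: "nat \<Rightarrow> real" where
  "harm_excess k = harm (k - 1) - ln (real k)"

lemma harm_excess_tendsto: "harm_excess \<longlonglongrightarrow> euler_mascheroni"
proof -
  have "(\<lambda>k. harm k - ln (real k) - 1 / real k) \<longlonglongrightarrow> euler_mascheroni - (0::real)"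
    by (intro tendsto_diff euler_mascheroni_LIMSEQ lim_1_over_n)
  moreover have "eventually (\<lambda>k. harm k - ln (real k) - 1 / real k = harm_excess k) sequentially"
    using eventually_gt_at_top[of 0]
    by eventually_elim (simp add: harm_excess_def harm_pred)
  ultimately show ?thesis by (simp add: tendsto_cong)
qed

lemma harm_excess_mono: "0 < k \<Longrightarrow> k \<le> l \<Longrightarrow> harm_excess k \<le> harm_excess l"
proof -
  have step: "harm_excess (Suc j) \<le> harm_excess (Suc (Suc j))" for j
  proof -
    have "ln (real (Suc (Suc j)) / real (Suc j)) \<le> real (Suc (Suc j)) / real (Suc j) - 1"
      by (intro ln_le_minus_one) simp
    also have "\<dots> = inverse (real (Suc j))" by (simp add: field_simps)
    finally have "ln (real (Suc (Suc j))) - ln (real (Suc j)) \<le> inverse (real (Suc j))"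
      by (subst (asm) ln_div) auto
    then show ?thesis by (simp add: harm_excess_def harm_Suc del: of_nat_Suc)
  qed
  have "incseq (\<lambda>j. harm_excess (Suc j))" using step by (rule incseq_SucI)
  from incseqD[OF this, of "k - 1" "l - 1"]
 show "0 < k \<Longrightarrow> k \<le> l \<Longrightarrow> harm_excess k \<le> harm_excess l" by simp
qed

lemma harm_excess_le: "0 < k \<Longrightarrow> harm_excess k \<le> euler_mascheroni"
  using harm_excess_mono
  by (intro LIMSEQ_le_const[OF harm_excess_tendsto] exI[of _ k]) auto

text \<open>The potential, normalised so that its limit is \<open>0\<close> when the composition tends to \<open>p\<close>. A colour with
  \<open>p x = 0\<close> contributes nothing, since \<open>ln 0 = 0\<close>.\<close>

definition entropy_gap :: "'a set \<Rightarrow> ('a \<Rightarrow> real) \<Rightarrow> ('a \<Rightarrow> nat) \<Rightarrow> real" where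
  "entropy_gap X p n = potential X p n + (\<Sum>x\<in>X. p x * ln (p x))"

lemma entropy_gap_eq:
  assumes "finite X" "X \<noteq> {}" "p \<in> distributions X" "n \<in> urns X"
  shows "entropy_gap X p n = harm_excess (sum n X) - (\<Sum>x\<in>X. p x * harm_excess (n x))
    + (\<Sum>x\<in>X. p x * (ln (p x) - ln (composition X n x)))"
proof -
  have one: "(\<Sum>x\<in>X. p x) = 1" using assms(3) by (simp add: distributions_def)
  have ln: "ln (composition X n x) = ln (real (n x)) - ln (real (sum n X))" if "x \<in> X" for x
    unfolding composition_def using urn_total_pos[OF assms(1,2,4)] assms(4) that
    by (intro ln_divide_pos) (auto simp: urns_def simp del: of_nat_sum)
  have "(\<Sum>x\<in>X. p x * (ln (p x) - ln (composition X n x)))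
      = (\<Sum>x\<in>X. p x * ln (p x) - p x * ln (real (n x)) + p x * ln (real (sum n X)))"
    by (intro sum.cong) (auto simp: ln algebra_simps)
  also have "\<dots> = (\<Sum>x\<in>X. p x * ln (p x)) - (\<Sum>x\<in>X. p x * ln (real (n x))) + ln (real (sum n X))"
    unfolding sum.distrib sum_subtractf sum_distrib_right[symmetric] one by simp
  finally show ?thesis
    by (simp add: entropy_gap_def potential_def harm_excess_def right_diff_distrib sum_subtractf del: of_nat_sum)
qed

lemma sum_composition:
  assumes "finite X" "X \<noteq> {}" "n \<in> urns X"
  shows "sum (composition X n) X = 1" "\<And>x. x \<in> X \<Longrightarrow> composition X n x > 0"
    "\<And>x. x \<in> X \<Longrightarrow> composition X n x \<le> 1"
proof -
  have d: "composition X n \<in> distributions X" by (rule composition_in_distributions[OF assms])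
  then show "sum (composition X n) X = 1" by (simp add: distributions_def)
  show "composition X n x > 0" if "x \<in> X" for x
    using urn_total_pos[OF assms] assms(3) that
    by (auto simp: composition_def urns_def simp del: of_nat_sum)
  show "composition X n x \<le> 1" if "x \<in> X" for x
    using member_le_sum[OF that, of "composition X n"] d assms(1) by (auto simp: distributions_def)
qed

text \<open>Apply \<open>ln y \<le> y - 1\<close> to \<open>y = sqrt (q x / p x)\<close>.\<close>

lemma relative_entropy_ge_hellinger:
  assumes "finite X" "p \<in> distributions X" "sum q X = 1" "\<And>x. x \<in> X \<Longrightarrow> q x > 0"
  shows "(\<Sum>x\<in>X. (sqrt (p x) - sqrt (q x))\<^sup>2) \<le> (\<Sum>x\<in>X. p x * (ln (p x) - ln (q x)))"
proof -
  have p: "\<And>x. x \<in> X \<Longrightarrow> 0 \<le> p x" "sum p X = 1"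
    using assms by (auto simp: distributions_def)
  have ge: "2 * p x - 2 * (sqrt (p x) * sqrt (q x)) \<le> p x * (ln (p x) - ln (q x))" if "x \<in> X" for x
  proof (cases "p x = 0")
    case False
    then have px: "p x > 0" using p(1)[OF that] by simp
    have qx: "q x > 0" by (rule assms(4)[OF that])
    have "ln (q x / p x) = 2 * ln (sqrt (q x / p x))"
      using px qx by (simp add: ln_sqrt)
    also have "\<dots> \<le> 2 * (sqrt (q x / p x) - 1)"
      using px qx by (intro mult_left_mono ln_le_minus_one) auto
    finally have "p x * ln (q x / p x) \<le> p x * (2 * (sqrt (q x / p x) - 1))"
      using px by (intro mult_left_mono) auto
    also have "p x * (2 * (sqrt (q x / p x) - 1)) = 2 * (sqrt (p x) * sqrt (p x) * (sqrt (q x) / sqrt (p x))) - 2 * p x"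
      using px by (simp add: real_sqrt_divide algebra_simps)
    also have "sqrt (p x) * sqrt (p x) * (sqrt (q x) / sqrt (p x)) = sqrt (p x) * sqrt (q x)"
    proof -
      have cancel: "a * a * (b / a) = a * b" if "a \<noteq> 0" for a b :: real using that by simp
      show ?thesis by (rule cancel) (use px in simp)
    qed
    also have "ln (q x / p x) = ln (q x) - ln (p x)" using px qx by (intro ln_divide_pos) auto
    finally show ?thesis by (simp add: algebra_simps)
  qed simp
  have "(\<Sum>x\<in>X. (sqrt (p x) - sqrt (q x))\<^sup>2) = (\<Sum>x\<in>X. p x + q x - 2 * (sqrt (p x) * sqrt (q x)))"
    using p assms(4) by (intro sum.cong) (auto simp: power2_diff less_imp_le)
  also have "\<dots> = (\<Sum>x\<in>X. 2 * p x - 2 * (sqrt (p x) * sqrt (q x)))"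
    using p(2) assms(3) by (simp add: sum.distrib sum_subtractf sum_distrib_left[symmetric])
  also have "\<dots> \<le> (\<Sum>x\<in>X. p x * (ln (p x) - ln (q x)))" by (intro sum_mono ge)
  finally show ?thesis .
qed

text \<open>The relative entropy is the exact main term in \<open>entropy_gap_eq\<close>. Of the two error terms, the one
  from single colours has a favourable sign, and the one from the total number of balls vanishes as
  the urn grows.\<close>

lemma hellinger_le_entropy_gap:
  assumes "finite X" "X \<noteq> {}" "p \<in> distributions X" "n \<in> urns X"
  shows "(\<Sum>x\<in>X. (sqrt (p x) - sqrt (composition X n x))\<^sup>2)
    \<le> entropy_gap X p n + (euler_mascheroni - harm_excess (sum n X))"
proof -
  have p: "\<And>x. x \<in> X \<Longrightarrow> 0 \<le> p x" "sum p X = 1"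
    using assms(3) by (auto simp: distributions_def)
  have "(\<Sum>x\<in>X. p x * harm_excess (n x)) \<le> (\<Sum>x\<in>X. p x * euler_mascheroni)"
    using p assms(4) by (intro sum_mono mult_left_mono harm_excess_le) (auto simp: urns_def)
  also have "\<dots> = euler_mascheroni" by (simp add: sum_distrib_right[symmetric] p(2))
  finally show ?thesis
    using relative_entropy_ge_hellinger[OF assms(1,3) sum_composition(1,2)[OF assms(1,2,4)]]
      entropy_gap_eq[OF assms] by linarith
qed

lemma entropy_gap_ge:
  assumes "finite X" "X \<noteq> {}" "p \<in> distributions X" "n \<in> urns X" "0 < m" "m \<le> sum n X"
  shows "- (euler_mascheroni - harm_excess m) \<le> entropy_gap X p n"
proof -
  have "0 \<le> (\<Sum>x\<in>X. (sqrt (p x) - sqrt (composition X n x))\<^sup>2)" by (intro sum_nonneg) auto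
  then show ?thesis
    using hellinger_le_entropy_gap[OF assms(1-4)] harm_excess_mono[OF assms(5,6)] by linarith
qed

section \<open>Small drift forces small relative entropy\<close>

lemma pointwise_convergent_subsequence:
  fixes f :: "nat \<Rightarrow> 'a \<Rightarrow> real"
  assumes "finite X" "\<And>k x. x \<in> X \<Longrightarrow> f k x \<in> {a..b}"
  shows "\<exists>r l. strict_mono (r::nat\<Rightarrow>nat) \<and> (\<forall>x\<in>X. (\<lambda>k. f (r k) x) \<longlonglongrightarrow> l x)"
  using assms
proof (induction X)
  case empty
  show ?case by (intro exI[of _ id]) (auto simp: strict_mono_id)
next
  case (insert z X)
  then obtain r l where r: "strict_mono r" "\<forall>x\<in>X. (\<lambda>k. f (r k) x) \<longlonglongrightarrow> l x" by blast
  have "seq_compact {a..b}" by (intro compact_imp_seq_compact compact_Icc)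
  moreover have "\<forall>k. f (r k) z \<in> {a..b}" using insert.prems by blast
  ultimately obtain c s where s: "strict_mono s" "((\<lambda>k. f (r k) z) \<circ> s) \<longlonglongrightarrow> c"
    by (rule seq_compactE)
  have "(\<lambda>k. f ((r \<circ> s) k) x) \<longlonglongrightarrow> (l(z := c)) x" if "x \<in> insert z X" for x
  proof (cases "x = z")
    case True
    then show ?thesis using s(2) by (simp add: comp_def)
  next
    case False
    then have "(\<lambda>k. f (r k) x) \<longlonglongrightarrow> l x" using r that by auto
    from LIMSEQ_subseq_LIMSEQ[OF this s(1)] show ?thesis using False by (simp add: comp_def)
  qed
  then show ?case using strict_mono_o[OF r(1) s(1)] by blast
qed

lemma drift_bound_tendsto:
  assumes "\<And>x. x \<in> X \<Longrightarrow> (\<lambda>k. q k x) \<longlonglongrightarrow> l x"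
  shows "(\<lambda>k. drift_bound X T p (q k)) \<longlonglongrightarrow> drift_bound X T p l"
  unfolding drift_bound_def mixed_payoff_def gain_def
  by (intro tendsto_intros assms) auto

text \<open>Only colours with \<open>p x > 0\<close> enter the sums, and for these the number of balls tends to infinity.\<close>

lemma entropy_gap_tendsto_0:
  assumes "finite X" "X \<noteq> {}" "p \<in> distributions X" "\<And>k. n k \<in> urns X"
    and total: "filterlim (\<lambda>k. sum (n k) X) at_top sequentially"
    and lim: "\<And>x. x \<in> X \<Longrightarrow> (\<lambda>k. composition X (n k) x) \<longlonglongrightarrow> p x"
  shows "(\<lambda>k. entropy_gap X p (n k)) \<longlonglongrightarrow> 0"
proof -
  have p: "\<And>x. x \<in> X \<Longrightarrow> 0 \<le> p x" "sum p X = 1"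
    using assms(3) by (auto simp: distributions_def)
  have total': "(\<lambda>k. harm_excess (sum (n k) X)) \<longlonglongrightarrow> euler_mascheroni"
    by (rule filterlim_compose[OF harm_excess_tendsto total])
  have excess: "(\<lambda>k. p x * harm_excess (n k x)) \<longlonglongrightarrow> p x * euler_mascheroni" if x: "x \<in> X" for x
  proof (cases "p x = 0")
    case False
    then have px: "p x > 0" using p(1)[OF x] by simp
    have "filterlim (\<lambda>k. composition X (n k) x * real (sum (n k) X)) at_top sequentially"
      using lim[OF x] px filterlim_compose[OF filterlim_real_sequentially total]
      by (rule filterlim_tendsto_pos_mult_at_top)
    moreover have "composition X (n k) x * real (sum (n k) X) = real (n k x)" for k
      using urn_total_pos[OF assms(1,2,4), of k] by (simp add: composition_def del: of_nat_sum)
    ultimately have "filterlim (\<lambda>k. n k x) at_top sequentially"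
      by (simp add: filterlim_sequentially_iff_filterlim_real del: of_nat_sum)
    then show ?thesis
      by (intro tendsto_intros filterlim_compose[OF harm_excess_tendsto])
  qed simp
  have entropy: "(\<lambda>k. p x * (ln (p x) - ln (composition X (n k) x))) \<longlonglongrightarrow> 0" if x: "x \<in> X" for x
  proof (cases "p x = 0")
    case False
    have "(\<lambda>k. p x * (ln (p x) - ln (composition X (n k) x))) \<longlonglongrightarrow> p x * (ln (p x) - ln (p x))"
      by (intro tendsto_intros lim x False)
    then show ?thesis by simp
  qed simp
  have "(\<lambda>k. entropy_gap X p (n k)) \<longlonglongrightarrow>
      euler_mascheroni - (\<Sum>x\<in>X. p x * euler_mascheroni) + (\<Sum>x\<in>X. 0)"
    unfolding entropy_gap_eq[OF assms(1-4)]
    by (intro tendsto_intros total' excess entropy)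
  then show ?thesis by (simp add: sum_distrib_right[symmetric] p(2))
qed

text \<open>Compactness of the simplex: along a sequence of larger and larger urns with vanishing drift, some
  subsequence of compositions converges, and its limit has zero drift, so it is \<open>p\<close>.\<close>

lemma entropy_gap_small_if_drift_small:
  assumes "finite X" "X \<noteq> {}" "tournament X T" "optimal_strategy X T p" "\<epsilon> > 0"
  shows "\<exists>\<eta>>0. \<exists>m. \<forall>n\<in>urns X. m \<le> sum n X \<longrightarrow> drift_bound X T p (composition X n) < \<eta>
    \<longrightarrow> entropy_gap X p n < \<epsilon>"
proof (rule ccontr)
  assume "\<not> ?thesis"
  then have "\<forall>k::nat. \<exists>n\<in>urns X. k \<le> sum n X \<and> drift_bound X T p (composition X n) < 1 / real (Suc k)
      \<and> \<not> entropy_gap X p n < \<epsilon>"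
    by (metis zero_less_divide_1_iff of_nat_0_less_iff zero_less_Suc)
  then obtain n where n: "\<And>k. n k \<in> urns X" "\<And>k. k \<le> sum (n k) X"
      "\<And>k. drift_bound X T p (composition X (n k)) < 1 / real (Suc k)" 
      "\<And>k. \<epsilon> \<le> entropy_gap X p (n k)"
    by (metis not_less)
  note sc = sum_composition[OF assms(1,2) n(1)]
  have pd: "p \<in> distributions X" using assms(4) by (simp add: optimal_strategy_def)
  have "\<exists>r l. strict_mono (r::nat\<Rightarrow>nat) \<and> (\<forall>x\<in>X. (\<lambda>k. composition X (n (r k)) x) \<longlonglongrightarrow> l x)"
    by (rule pointwise_convergent_subsequence[OF assms(1), of "\<lambda>k. composition X (n k)" 0 1])
      (use sc in \<open>auto simp: less_imp_le\<close>)
  then obtain r l where r: "strict_mono (r::nat\<Rightarrow>nat)"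
    and l: "\<And>x. x \<in> X \<Longrightarrow> (\<lambda>k. composition X (n (r k)) x) \<longlonglongrightarrow> l x" by blast
  define q where "q x = (if x \<in> X then l x else 0)" for x
  have q: "(\<lambda>k. composition X (n (r k)) x) \<longlonglongrightarrow> q x" if "x \<in> X" for x
    using l that by (simp add: q_def)
  have qd: "q \<in> distributions X"
  proof -
    have "0 \<le> q x" if "x \<in> X" for x
      by (rule LIMSEQ_le_const[OF q[OF that]]) (use sc(2) that in \<open>auto simp: less_imp_le\<close>)
    moreover have "(\<lambda>k. \<Sum>x\<in>X. composition X (n (r k)) x) \<longlonglongrightarrow> (\<Sum>x\<in>X. q x)"
      by (intro tendsto_intros q)
    then have "sum q X = 1" by (simp add: sc(1) LIMSEQ_const_iff)
    ultimately show ?thesis by (auto simp: distributions_def q_def)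
  qed
  have "drift_bound X T p q \<le> 0"
  proof (rule LIMSEQ_le[OF drift_bound_tendsto[OF q]])
    show "(\<lambda>k. 1 / real (Suc (r k))) \<longlonglongrightarrow> 0"
      using LIMSEQ_subseq_LIMSEQ[OF LIMSEQ_Suc[OF lim_1_over_n] r] by (simp add: comp_def)
  qed (use n(3) in \<open>auto simp: less_imp_le\<close>)
  then have "q x = p x" if "x \<in> X" for x
    by (rule drift_bound_zero[OF assms(1,3,4) qd _ that])
  then have lim: "(\<lambda>k. composition X (n (r k)) x) \<longlonglongrightarrow> p x" if "x \<in> X" for x
    using q[OF that] that by simp
  have "filterlim (\<lambda>k. sum (n k) X) at_top sequentially"
    by (rule filterlim_at_top_mono[OF filterlim_ident]) (use n(2) in auto)
  then have "filterlim (\<lambda>k. sum (n (r k)) X) at_top sequentially"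
    by (rule filterlim_compose[OF _ filterlim_subseq[OF r]])
  then have "(\<lambda>k. entropy_gap X p (n (r k))) \<longlonglongrightarrow> 0"
    by (intro entropy_gap_tendsto_0 assms(1,2) pd n(1) lim)
  then have "\<epsilon> \<le> 0" by (rule LIMSEQ_le_const) (use n(4) in auto)
  then show False using assms(5) by simp
qed

text \<open>Otherwise the harmonic series would converge.\<close>

lemma drift_small_infinitely_often:
  fixes d :: "nat \<Rightarrow> real" and N :: "nat \<Rightarrow> nat"
  assumes "\<And>t. 0 \<le> d t" "\<And>t. N t = N 0 + t" "\<And>k. (\<Sum>i\<le>k. d i / real (N i)) < c" "\<eta> > 0"
  shows "\<exists>t\<ge>m. d t < \<eta>"
proof (rule ccontr)
  assume "\<not> ?thesis"
  then have ge: "\<eta> \<le> d t" if "t \<ge> m" for t using that by (auto simp: not_less)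
  have "summable (\<lambda>t. d t / real (N t))"
  proof (rule bounded_imp_summable)
    show "0 \<le> d t / real (N t)" for t using assms(1) by simp
    show "(\<Sum>i\<le>k. d i / real (N i)) \<le> c" for k using assms(3)[of k] by simp
  qed
  then have "summable (\<lambda>t. \<eta> * inverse (real (N t)))"
  proof (rule summable_comparison_test_ev[rotated])
    show "eventually (\<lambda>t. norm (\<eta> * inverse (real (N t))) \<le> d t / real (N t)) sequentially"
      using eventually_ge_at_top[of m]
    proof eventually_elim
      case (elim t)
      then show ?case using ge[OF elim] assms(4) by (simp add: divide_inverse mult_right_mono)
    qed
  qed
  then have "summable (\<lambda>t. inverse \<eta> * (\<eta> * inverse (real (N t))))" by (rule summable_mult)
  then have "summable (\<lambda>t. inverse (real (t + N 0)))"
    using assms(4) by (subst (asm) assms(2)) (simp add: add.commute mult.assoc[symmetric])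
  then have "summable (\<lambda>t. inverse (real t))" by (simp only: summable_iff_shift[of "\<lambda>t. inverse (real t)"])
  then show False using not_summable_harmonic[where 'a=real] by simp
qed

section \<open>Convergence of three-alternatives reinforcement\<close>

lemma countable_urns: "finite X \<Longrightarrow> countable (urns X)"
proof -
  assume "finite X"
  then have "countable (PiE X (\<lambda>_. UNIV :: nat set))" by (intro countable_PiE) auto
  moreover have "urns X \<subseteq> (\<lambda>f x. if x \<in> X then f x else 0) ` PiE X (\<lambda>_. UNIV)"
  proof
    fix n assume "n \<in> urns X"
    then show "n \<in> (\<lambda>f x. if x \<in> X then f x else 0) ` PiE X (\<lambda>_. UNIV)"
      by (intro image_eqI[of _ _ "restrict n X"]) (auto simp: urns_def fun_eq_iff)
  qed
  ultimately show "countable (urns X)"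
    by (rule countable_subset[OF _ countable_image, rotated])
qed

lemma set_pmf_step:
  assumes "finite X" "X \<noteq> {}" "n \<in> urns X"
  shows "set_pmf (three_alternatives_step X T n) \<subseteq> {n' \<in> urns X. sum n' X = sum n X + 1}"
    and "finite (set_pmf (three_alternatives_step X T n))"
proof -
  have sub: "set_pmf (winner X T n) \<subseteq> X" by (rule set_pmf_winner[OF assms])
  have "n(x := n x + 1) \<in> urns X" if "x \<in> X" for x using assms(3) that by (auto simp: urns_def)
  then show "set_pmf (three_alternatives_step X T n) \<subseteq> {n' \<in> urns X. sum n' X = sum n X + 1}"
    using sub sum_add_ball[OF assms(1)] unfolding three_alternatives_step_eq by auto
  show "finite (set_pmf (three_alternatives_step X T n))"
    using finite_subset[OF sub assms(1)] by (simp add: three_alternatives_step_eq)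
qed

lemma composition_tendsto:
  assumes "finite X" "X \<noteq> {}" "p \<in> distributions X" "\<And>t. n t \<in> urns X"
    and total: "filterlim (\<lambda>t. sum (n t) X) at_top sequentially"
    and gap: "\<And>\<delta>. \<delta> > 0 \<Longrightarrow> eventually (\<lambda>t. entropy_gap X p (n t) < \<delta>) sequentially"
    and "x \<in> X"
  shows "(\<lambda>t. composition X (n t) x) \<longlonglongrightarrow> p x"
proof -
  let ?q = "\<lambda>t. composition X (n t) x"
  define u where "u t = entropy_gap X p (n t) + (euler_mascheroni - harm_excess (sum (n t) X))" for t
  have lim: "(\<lambda>t. harm_excess (sum (n t) X)) \<longlonglongrightarrow> euler_mascheroni"
    by (rule filterlim_compose[OF harm_excess_tendsto total])
  have le: "(sqrt (p x) - sqrt (?q t))\<^sup>2 \<le> u t" for t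
  proof -
    have "(sqrt (p x) - sqrt (?q t))\<^sup>2 \<le> (\<Sum>x\<in>X. (sqrt (p x) - sqrt (composition X (n t) x))\<^sup>2)"
      using assms(1,7) by (intro member_le_sum) auto
    also have "\<dots> \<le> u t" unfolding u_def by (rule hellinger_le_entropy_gap[OF assms(1-4)])
    finally show ?thesis .
  qed
  have u: "u \<longlonglongrightarrow> 0"
  proof (rule order_tendstoI)
    fix a :: real assume "a < 0"
    moreover have "0 \<le> u t" for t using le[of t] order_trans zero_le_power2 by blast
    ultimately show "eventually (\<lambda>t. a < u t) sequentially"
      by (intro always_eventually) (metis less_le_trans)
  next
    fix a :: real assume "0 < a"
    then have "eventually (\<lambda>t. entropy_gap X p (n t) < a / 2) sequentially" by (intro gap) simp
    moreover have "eventually (\<lambda>t. euler_mascheroni - a / 2 < harm_excess (sum (n t) X)) sequentially"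
      using \<open>0 < a\<close> by (intro order_tendstoD(1)[OF lim]) simp
    ultimately show "eventually (\<lambda>t. u t < a) sequentially"
      by eventually_elim (simp add: u_def)
  qed
  have "(\<lambda>t. (sqrt (p x) - sqrt (?q t))\<^sup>2) \<longlonglongrightarrow> 0"
    by (rule tendsto_sandwich[OF _ _ tendsto_const u]) (use le in auto)
  then have "(\<lambda>t. sqrt ((sqrt (p x) - sqrt (?q t))\<^sup>2)) \<longlonglongrightarrow> sqrt 0" by (rule tendsto_real_sqrt)
  then have "(\<lambda>t. sqrt (p x) - sqrt (?q t)) \<longlonglongrightarrow> 0" by (simp add: tendsto_rabs_zero_iff)
  then have "(\<lambda>t. (sqrt (p x) - (sqrt (p x) - sqrt (?q t)))\<^sup>2) \<longlonglongrightarrow> (sqrt (p x) - 0)\<^sup>2"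
    by (intro tendsto_intros)
  moreover have "(sqrt (?q t))\<^sup>2 = ?q t" for t
    using sum_composition(2)[OF assms(1,2,4) assms(7), of t] by (simp add: less_imp_le)
  moreover have "p x \<ge> 0" using assms(3,7) by (simp add: distributions_def)
  ultimately show ?thesis by simp
qed

theorem theorem4:
  fixes X :: "'a set" and T :: "'a \<Rightarrow> 'a \<Rightarrow> bool" and p :: "'a \<Rightarrow> real"
    and n0 :: "'a \<Rightarrow> nat" and M :: "'w measure" and N :: "nat \<Rightarrow> 'w \<Rightarrow> 'a \<Rightarrow> nat"
  assumes "finite X" and "X \<noteq> {}" and "tournament X T"
    and "optimal_strategy X T p"
    and "n0 \<in> urns X"
    and "prob_space M"
    and "three_alternatives_reinforcement M X T n0 N"
  shows "AE \<omega> in M. \<forall>x\<in>X. (\<lambda>t. composition X (N t \<omega>) x) \<longlonglongrightarrow> p x"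
proof -
  interpret prob_space M by fact
  note fX = assms(1,2)
  let ?K = "three_alternatives_step X T" and ?S = "urns X"
  let ?V = "entropy_gap X p"
  let ?D = "\<lambda>n. drift_bound X T p (composition X n)"
  have pd: "p \<in> distributions X" using assms(4) by (simp add: optimal_strategy_def)
  have mc: "markov_chain M ?S ?K N" and N0: "AE \<omega> in M. N 0 \<omega> = n0"
    using assms(7) by (auto simp: three_alternatives_reinforcement_def)
  have cS: "countable ?S" by (rule countable_urns[OF assms(1)])
  have closed: "set_pmf (?K n) \<subseteq> ?S" if "n \<in> ?S" for n
    using set_pmf_step(1)[OF fX that] by blast
  have fin: "finite (set_pmf (?K n))" if "n \<in> ?S" for n
    by (rule set_pmf_step(2)[OF fX that])
  have D0: "0 \<le> ?D n" if "n \<in> ?S" for n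
    by (rule drift_bound_nonneg[OF assms(4) composition_in_distributions[OF fX that]])
  have grow: "AE \<omega> in M. \<forall>t. N t \<omega> \<in> {n \<in> ?S. sum n X = sum n0 X + t}"
  proof (rule AE_markov_invariant[OF mc cS N0 closed assms(5)])
    show "set_pmf (?K n) \<subseteq> {n \<in> ?S. sum n X = sum n0 X + Suc t}"
      if "n \<in> {n \<in> ?S. sum n X = sum n0 X + t}" for n t
      using set_pmf_step(1)[OF fX, of n T] that by auto
  qed (use assms(5) in auto)
  have occupation: "AE \<omega> in M. \<exists>c. \<forall>k. (\<Sum>i\<le>k. ?D (N i \<omega>) / real (sum (N i \<omega>) X)) < c"
  proof (rule AE_bounded_occupation[OF mc cS N0 closed assms(5) fin, where V = "potential X p"])
    show "0 \<le> potential X p n" for n by (rule potential_nonneg[OF assms(1) pd])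
    show "0 \<le> ?D n / real (sum n X)" if "n \<in> ?S" for n
      using D0[OF that] by (rule divide_nonneg_nonneg[OF _ of_nat_0_le_iff])
    show "measure_pmf.expectation (?K n) (potential X p) \<le> potential X p n - ?D n / real (sum n X)"
      if "n \<in> ?S" for n by (rule expectation_potential_le[OF assms(1-4) that])
  qed
  \<comment> \<open>the first part bounds the gap from below; the summand \<open>1 / Suc j\<close> keeps the tolerance positive, so that returns below it exist\<close>
  define r where "r j = (euler_mascheroni - harm_excess (Suc j)) + 1 / real (Suc j)" for j
  have r_pos: "r j > 0" for j
    using harm_excess_le[of "Suc j"] by (simp add: r_def add_nonneg_pos)
  have returns: "AE \<omega> in M. \<forall>j. \<exists>t. N t \<omega> \<in> {n \<in> ?S. Suc j \<le> sum n X} \<and> ?V (N t \<omega>) \<le> r j"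
    using grow occupation
  proof eventually_elim
    case (elim \<omega>)
    then have mem: "N t \<omega> \<in> ?S" and total: "sum (N t \<omega>) X = sum n0 X + t" for t by auto
    obtain c where c: "\<And>k. (\<Sum>i\<le>k. ?D (N i \<omega>) / real (sum (N i \<omega>) X)) < c" using elim by blast
    show ?case
    proof
      fix j
      obtain \<eta> m where \<eta>: "\<eta> > 0" and m: "\<And>n. n \<in> ?S \<Longrightarrow> m \<le> sum n X \<Longrightarrow> ?D n < \<eta> \<Longrightarrow> ?V n < r j"
        using entropy_gap_small_if_drift_small[OF assms(1-4) r_pos[of j]] by blast
      obtain t where t: "t \<ge> max m (Suc j)" "?D (N t \<omega>) < \<eta>"
        using drift_small_infinitely_often[of "\<lambda>t. ?D (N t \<omega>)" "\<lambda>t. sum (N t \<omega>) X" c \<eta> "max m (Suc j)"]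
          D0[OF mem] total c \<eta> by auto
      then have "?V (N t \<omega>) < r j" using mem total by (intro m) auto
      then show "\<exists>t. N t \<omega> \<in> {n \<in> ?S. Suc j \<le> sum n X} \<and> ?V (N t \<omega>) \<le> r j"
        using t mem total by (intro exI[of _ t]) auto
    qed
  qed
  have "AE \<omega> in M. \<forall>\<delta>>0. eventually (\<lambda>t. ?V (N t \<omega>) < \<delta>) sequentially"
  proof (rule AE_limsup_nonpos_of_returns[OF mc cS N0 closed assms(5) fin _ _ _ _ _ _ returns])
    show "measure_pmf.expectation (?K n) ?V \<le> ?V n" if "n \<in> ?S" for n
    proof -
      have "measure_pmf.expectation (?K n) ?V
          = measure_pmf.expectation (?K n) (potential X p) + (\<Sum>x\<in>X. p x * ln (p x))"
        unfolding entropy_gap_def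
        by (subst Bochner_Integration.integral_add)
          (auto intro!: integrable_measure_pmf_finite fin[OF that])
      moreover have "0 \<le> ?D n / real (sum n X)"
        using D0[OF that] by (rule divide_nonneg_nonneg[OF _ of_nat_0_le_iff])
      ultimately show ?thesis
        using expectation_potential_le[OF assms(1-4) that] unfolding entropy_gap_def by linarith
    qed
    show "- r j \<le> ?V n" if "n \<in> {n \<in> ?S. Suc j \<le> sum n X}" for n j
    proof -
      have "- (euler_mascheroni - harm_excess (Suc j)) \<le> ?V n"
        using that by (intro entropy_gap_ge fX pd) auto
      moreover have "0 \<le> 1 / real (Suc j)" by simp
      ultimately show ?thesis unfolding r_def by linarith
    qed
    have "(\<lambda>j. (euler_mascheroni - harm_excess (Suc j)) + 1 / real (Suc j)) \<longlonglongrightarrow> (euler_mascheroni - euler_mascheroni) + 0"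
      by (intro tendsto_intros LIMSEQ_Suc[OF harm_excess_tendsto] LIMSEQ_Suc[OF lim_1_over_n])
    then show "r \<longlonglongrightarrow> 0" by (simp add: r_def[abs_def])
    show "r j \<ge> 0" for j using r_pos[of j] by simp
    show "set_pmf (?K n) \<subseteq> {n \<in> ?S. Suc j \<le> sum n X}" if "n \<in> {n \<in> ?S. Suc j \<le> sum n X}" for n j
      using set_pmf_step(1)[OF fX, of n T] that by auto
  qed auto
  with grow show ?thesis
  proof eventually_elim
    case (elim \<omega>)
    then have mem: "N t \<omega> \<in> ?S" and total: "sum (N t \<omega>) X = sum n0 X + t" for t by auto
    have "filterlim (\<lambda>t. sum (N t \<omega>) X) at_top sequentially"
      by (rule filterlim_at_top_mono[OF filterlim_ident]) (auto simp: total)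
    then show ?case
      using elim(2) by (intro ballI composition_tendsto[OF fX pd mem]) auto
  qed
qed

end
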